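(* Let $m\geqslant1$ and $n\geqslant 1$ be integers. Let $${}^{(m)}\mathrm{Sh}_{1,n-1}=\left(1+s_{n-1}+s_{n-2}s_{n-1}+\dots+s_1s_2\cdots s_{n-1}\right)\left(1+t_n+t_n^2+\dots+t_n^{m-1}\right)\in\mathbb{Z}G(m,1,n),$$ and let $P$ be the matrix, with rows and columns indexed by the elements of $G(m,1,n)$, obtained by dividing by $mn$ the matrix, in the basis of group elements, of the operator $y\mapsto {}^{(m)}\mathrm{Sh}_{1,n-1}\,y$ of left multiplication on the group algebra. Then $P$ is a doubly stochastic matrix of transition probabilities, the underlying Markov chain is ergodic, and its unique stationary probability distribution is uniform. Moreover, the convergence to stationarity occurs exponentially fast, with the rate governed by the second largest eigenvalue: there exists a constant $\alpha>0$ such that for all integers $k\geqslant1$ and all indices $i,j$, $$\left|(P^k)_{ij}-\frac{1}{m^n n!}\right|\leqslant\begin{cases}\alpha\left(\frac{n-2}{n}\right)^k & \text{if } m=1,\\[4pt] \alpha\left(\frac{n-1}{n}\right)^k & \text{if } m>1.\end{cases}$$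
   Context: Let $C_m$ be the cyclic group of order $m$ with generator $\gamma$, and let $E=\{(x,\rho): x\in\{1,\dots,n\},\ \rho\in C_m\}$, with $C_m$ acting on $E$ by $\rho\cdot(x,\rho')=(x,\rho\rho')$. The complex reflection group $G(m,1,n)$ is identified with the group of all permutations $\pi$ of the set $E$ such that $\pi(x,\rho)=\rho\cdot\pi(x,1)$ for all $x\in\{1,\dots,n\}$, $\rho\in C_m$. It has order $m^n n!$. The elements $s_1,\dots,s_{n-1},t$ of $G(m,1,n)$ are given by $s_i(x,1)=(\pi_i(x),1)$, where $\pi_i$ is the transposition $(i,i+1)$, and $t(1,1)=(1,\gamma)$, $t(x,1)=(x,1)$ for $x\neq1$. One sets $t_1=t$ and $t_{i+1}=s_it_is_i$ for $i=1,\dots,n-1$. The element ${}^{(m)}\mathrm{Sh}_{1,n-1}$ is a sum of $mn$ distinct group elements, and the Markov chain with transition matrix $P$ corresponds to repeated shuffles of a deck of $n$ polygonal cards, each shuffle being randomly picked among these $mn$ elements.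
   Formalization: The case m = n = 1 is excluded from the convergence-rate part (second largest eigenvalue and bound), because there P = (1) has no second eigenvalue and the bound 0 ≤ α(−1)^k fails for odd k; all other claims are proved for all m, n ≥ 1. *)

theory Defs
  imports
    "HOL-Algebra.Bij"
    "HOL-Algebra.Generated_Groups"
    "HOL-Combinatorics.Transposition"
    "HOL-Probability.Probability_Mass_Function"
begin

section \<open>The complex reflection group \<open>G(m,1,n)\<close>\<close>

text \<open>\<open>C\<close> is a cyclic group of order \<open>m\<close> (written multiplicatively) with generator \<open>\<gamma>\<close>.\<close>

definition colored_pts :: "('c, 'z) monoid_scheme \<Rightarrow> nat \<Rightarrow> (nat \<times> 'c) set"
  where "colored_pts C n = {1..n} \<times> carrier C"

definition color_act :: "('c, 'z) monoid_scheme \<Rightarrow> 'c \<Rightarrow> nat \<times> 'c \<Rightarrow> nat \<times> 'c"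
  where "color_act C \<rho> p = (fst p, \<rho> \<otimes>\<^bsub>C\<^esub> snd p)"

text \<open>The product of the group is composition, \<open>(\<pi> \<sigma>)(e) = \<pi> (\<sigma> e)\<close>.\<close>

definition refl_group :: "('c, 'z) monoid_scheme \<Rightarrow> nat \<Rightarrow> (nat \<times> 'c \<Rightarrow> nat \<times> 'c) monoid"
  where "refl_group C n = BijGroup (colored_pts C n)
    \<lparr>carrier := {\<pi> \<in> Bij (colored_pts C n).
       \<forall>x\<in>{1..n}. \<forall>\<rho>\<in>carrier C. \<pi> (x, \<rho>) = color_act C \<rho> (\<pi> (x, \<one>\<^bsub>C\<^esub>))}\<rparr>"

text \<open>An element of the group is determined by its values \<open>f x\<close> at the points \<open>(x, 1)\<close>.\<close>

definition equivariant_ext ::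
    "('c, 'z) monoid_scheme \<Rightarrow> nat \<Rightarrow> (nat \<Rightarrow> nat \<times> 'c) \<Rightarrow> nat \<times> 'c \<Rightarrow> nat \<times> 'c"
  where "equivariant_ext C n f = (\<lambda>p\<in>colored_pts C n. color_act C (snd p) (f (fst p)))"

definition s_elem :: "('c, 'z) monoid_scheme \<Rightarrow> nat \<Rightarrow> nat \<Rightarrow> nat \<times> 'c \<Rightarrow> nat \<times> 'c"
  where "s_elem C n i = equivariant_ext C n (\<lambda>x. (Transposition.transpose i (i + 1) x, \<one>\<^bsub>C\<^esub>))"

text \<open>\<open>t_elem C \<gamma> n i\<close> is \<open>t\<^sub>i\<close>, meaningful for \<open>1 \<le> i \<le> n\<close>; the value at \<open>i = 0\<close> is never used.\<close>

fun t_elem :: "('c, 'z) monoid_scheme \<Rightarrow> 'c \<Rightarrow> nat \<Rightarrow> nat \<Rightarrow> nat \<times> 'c \<Rightarrow> nat \<times> 'c"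
  where
    "t_elem C \<gamma> n 0 = \<one>\<^bsub>refl_group C n\<^esub>"
  | "t_elem C \<gamma> n (Suc 0) = equivariant_ext C n (\<lambda>x. (x, if x = 1 then \<gamma> else \<one>\<^bsub>C\<^esub>))"
  | "t_elem C \<gamma> n (Suc (Suc i)) =
       s_elem C n (Suc i) \<otimes>\<^bsub>refl_group C n\<^esub> t_elem C \<gamma> n (Suc i)
         \<otimes>\<^bsub>refl_group C n\<^esub> s_elem C n (Suc i)"

section \<open>The group ring of a finite group and the shuffle element\<close>

text \<open>Elements of the group ring are represented by their coefficient functions.\<close>

definition grp_basis :: "'a \<Rightarrow> 'a \<Rightarrow> int"
  where "grp_basis g = (\<lambda>h. if h = g then 1 else 0)"

definition grp_ring_mult ::
    "('a, 'z) monoid_scheme \<Rightarrow> ('a \<Rightarrow> int) \<Rightarrow> ('a \<Rightarrow> int) \<Rightarrow> 'a \<Rightarrow> int"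
  where "grp_ring_mult G a b =
    (\<lambda>g. \<Sum>(h, k) \<in> {(h, k) \<in> carrier G \<times> carrier G. h \<otimes>\<^bsub>G\<^esub> k = g}. a h * b k)"

text \<open>\<open>s_prod C n j\<close> is \<open>s\<^sub>j s\<^sub>j\<^sub>+\<^sub>1 \<dots> s\<^sub>n\<^sub>-\<^sub>1\<close>; it is \<open>1\<close> for \<open>j = n\<close>.\<close>

definition s_prod :: "('c, 'z) monoid_scheme \<Rightarrow> nat \<Rightarrow> nat \<Rightarrow> nat \<times> 'c \<Rightarrow> nat \<times> 'c"
  where "s_prod C n j =
    foldr (\<lambda>g h. g \<otimes>\<^bsub>refl_group C n\<^esub> h) (map (s_elem C n) [j..<n]) \<one>\<^bsub>refl_group C n\<^esub>"

definition Sh :: "('c, 'z) monoid_scheme \<Rightarrow> 'c \<Rightarrow> nat \<Rightarrow> (nat \<times> 'c \<Rightarrow> nat \<times> 'c) \<Rightarrow> int"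
  where "Sh C \<gamma> n = grp_ring_mult (refl_group C n)
    (\<lambda>g. \<Sum>j=1..n. grp_basis (s_prod C n j) g)
    (\<lambda>g. \<Sum>k<Coset.order C. grp_basis (t_elem C \<gamma> n n [^]\<^bsub>refl_group C n\<^esub> k) g)"

text \<open>As usual for the matrix of an operator, the column indexed by \<open>h\<close> holds the coordinates
  of the image of the basis vector \<open>h\<close>.\<close>

definition shuffle_matrix :: "('c, 'z) monoid_scheme \<Rightarrow> 'c \<Rightarrow> nat \<Rightarrow>
    (nat \<times> 'c \<Rightarrow> nat \<times> 'c) \<Rightarrow> (nat \<times> 'c \<Rightarrow> nat \<times> 'c) \<Rightarrow> real"
  where "shuffle_matrix C \<gamma> n g h =
    of_int (grp_ring_mult (refl_group C n) (Sh C \<gamma> n) (grp_basis h) g) / real (Coset.order C * n)"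

section \<open>Finite Markov chains\<close>

text \<open>Matrices are indexed by a finite set \<open>S\<close>; entries outside \<open>S \<times> S\<close> are irrelevant.
  In accordance with the column convention above, \<open>P i j\<close> is the probability of passing
  from state \<open>j\<close> to state \<open>i\<close>, so that distributions are column vectors.\<close>

primrec mat_pow :: "'a set \<Rightarrow> ('a \<Rightarrow> 'a \<Rightarrow> real) \<Rightarrow> nat \<Rightarrow> 'a \<Rightarrow> 'a \<Rightarrow> real"
  where
    "mat_pow S P 0 = (\<lambda>i j. if i = j then 1 else 0)"
  | "mat_pow S P (Suc k) = (\<lambda>i j. \<Sum>l\<in>S. P i l * mat_pow S P k l j)"

definition doubly_stochastic :: "'a set \<Rightarrow> ('a \<Rightarrow> 'a \<Rightarrow> real) \<Rightarrow> bool"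
  where "doubly_stochastic S P \<longleftrightarrow>
    (\<forall>i\<in>S. \<forall>j\<in>S. 0 \<le> P i j) \<and>
    (\<forall>i\<in>S. (\<Sum>j\<in>S. P i j) = 1) \<and>
    (\<forall>j\<in>S. (\<Sum>i\<in>S. P i j) = 1)"

definition irreducible_chain :: "'a set \<Rightarrow> ('a \<Rightarrow> 'a \<Rightarrow> real) \<Rightarrow> bool"
  where "irreducible_chain S P \<longleftrightarrow> (\<forall>i\<in>S. \<forall>j\<in>S. \<exists>k. 0 < mat_pow S P k i j)"

definition aperiodic_chain :: "'a set \<Rightarrow> ('a \<Rightarrow> 'a \<Rightarrow> real) \<Rightarrow> bool"
  where "aperiodic_chain S P \<longleftrightarrow> (\<forall>i\<in>S. Gcd {k. 1 \<le> k \<and> 0 < mat_pow S P k i i} = 1)"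

definition ergodic_chain :: "'a set \<Rightarrow> ('a \<Rightarrow> 'a \<Rightarrow> real) \<Rightarrow> bool"
  where "ergodic_chain S P \<longleftrightarrow> irreducible_chain S P \<and> aperiodic_chain S P"

definition stationary :: "'a set \<Rightarrow> ('a \<Rightarrow> 'a \<Rightarrow> real) \<Rightarrow> 'a pmf \<Rightarrow> bool"
  where "stationary S P \<mu> \<longleftrightarrow>
    set_pmf \<mu> \<subseteq> S \<and> (\<forall>i\<in>S. (\<Sum>j\<in>S. P i j * pmf \<mu> j) = pmf \<mu> i)"

definition eigenvalues :: "'a set \<Rightarrow> ('a \<Rightarrow> 'a \<Rightarrow> real) \<Rightarrow> complex set"
  where "eigenvalues S P =
    {z. \<exists>v. (\<exists>i\<in>S. v i \<noteq> 0) \<and> (\<forall>i\<in>S. (\<Sum>j\<in>S. complex_of_real (P i j) * v j) = z * v i)}"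

text \<open>Eigenvalues are compared by modulus and counted without multiplicity.\<close>

definition second_largest_eigenvalue :: "'a set \<Rightarrow> ('a \<Rightarrow> 'a \<Rightarrow> real) \<Rightarrow> real \<Rightarrow> bool"
  where "second_largest_eigenvalue S P r \<longleftrightarrow>
    complex_of_real r \<in> eigenvalues S P \<and> card {z \<in> eigenvalues S P. r < cmod z} = 1"

end

(* Let K_b be the sum of all group elements that keep the cards 1, ..., b unrotated and in their
   relative order, so that K_0 is the sum of all elements and K_n = 1. Undoing one shuffle gives
     Sh * K_b = m (n - b) K_b + K_(b-1)     (without the last term if b = 0).
   Hence P^k is the combination of the K_(n-a) with coefficients S(k,a) / (m^a n^k), where S(k,a) are
   Stirling numbers of the second kind. The identity sum_a S(k,a) n! / (n-a)! = n^k shows that the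
   terms with K_(n-a) = K_0 make up 1 / (m^n n!) up to an error of order (L/n)^k, where L is the
   largest a with K_(n-a) different from K_0: it is n - 1 if m > 1 and n - 2 if m = 1. The recurrence
   also shows that K_(n-L) - K_0 / (m (n-L)) is an eigenvector with eigenvalue L/n. *)

theory Submission
  imports Defs "HOL-Combinatorics.Stirling" "HOL-Algebra.Multiplicative_Group"
begin

subsection \<open>The group \<open>G(m,1,n)\<close>\<close>

text \<open>\<open>P\<close> is not symmetric in general: for n >= 3 the inverse of s_1 ... s_(n-1)
  is not a summand of the shuffle. So no orthonormal eigenbasis is at hand, and the bound is not
  read off from the spectrum. The argument runs the other way: the explicit formula for P^k bounds
  |(P^k)_ij - u|, where u = 1 / (m^n n!), by a constant times (L/n)^k, and this confines the
  spectrum. An eigenvector v for an eigenvalue z other than 1 has coordinate sum 0, because the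
  columns of P sum to 1. Then u cancels, and |z|^k |v_i| <= const (L/n)^k forces |z| <= L/n. The
  same estimate at z = 1, applied to the difference of a stationary and the uniform distribution,
  gives uniqueness. Only an eigenvector for L/n itself has to be exhibited. Ergodicity comes from
  the same formula, since its coefficients are nonnegative.\<close>

lemma color_act_simp [simp]: "color_act C \<rho> (x, \<tau>) = (x, \<rho> \<otimes>\<^bsub>C\<^esub> \<tau>)"
  by (simp add: color_act_def)

locale colored_perms = group C for C :: "('c, 'z) monoid_scheme" (structure) +
  fixes n :: nat
  assumes finite_colors: "finite (carrier C)"
begin

abbreviation "E \<equiv> colored_pts C n"
abbreviation "G \<equiv> refl_group C n"

lemma colored_pts_iff [simp]: "(x, \<rho>) \<in> E \<longleftrightarrow> x \<in> {1..n} \<and> \<rho> \<in> carrier C"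
  by (simp add: colored_pts_def)

lemma finite_colored_pts: "finite E"
  using finite_colors by (simp add: colored_pts_def)

lemma color_act_closed: "\<rho> \<in> carrier C \<Longrightarrow> p \<in> E \<Longrightarrow> color_act C \<rho> p \<in> E"
  by (cases p) auto

lemma color_act_mult:
  "\<rho> \<in> carrier C \<Longrightarrow> \<tau> \<in> carrier C \<Longrightarrow> p \<in> E \<Longrightarrow>
    color_act C \<rho> (color_act C \<tau> p) = color_act C (\<rho> \<otimes> \<tau>) p"
  by (cases p) (auto simp: m_assoc)

lemma carrier_refl_group:
  "carrier G =
    {\<pi> \<in> Bij E. \<forall>x\<in>{1..n}. \<forall>\<rho>\<in>carrier C. \<pi> (x, \<rho>) = color_act C \<rho> (\<pi> (x, \<one>))}"
  unfolding refl_group_def by simp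

lemma refl_group_apply:
  assumes "g \<in> carrier G" "x \<in> {1..n}" "\<rho> \<in> carrier C"
  shows "g (x, \<rho>) = color_act C \<rho> (g (x, \<one>))"
  using assms unfolding carrier_refl_group by blast

lemma refl_group_Bij: "g \<in> carrier G \<Longrightarrow> g \<in> Bij E"
  unfolding carrier_refl_group by blast

text \<open>The definition demands equivariance only from the points of colour 1; the symmetric form
  on all of \<open>E\<close> passes directly to composites and inverses.\<close>

lemma carrier_refl_group_iff:
  "g \<in> carrier G \<longleftrightarrow>
    g \<in> Bij E \<and> (\<forall>\<rho>\<in>carrier C. \<forall>p\<in>E. g (color_act C \<rho> p) = color_act C \<rho> (g p))"
proof
  assume g: "g \<in> carrier G"
  then have bij: "g \<in> Bij E"
    by (rule refl_group_Bij)
  have "g (color_act C \<rho> (x, \<tau>)) = color_act C \<rho> (g (x, \<tau>))"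
    if "\<rho> \<in> carrier C" "x \<in> {1..n}" "\<tau> \<in> carrier C" for \<rho> x \<tau>
  proof -
    have "g (x, \<one>) \<in> E"
      using that Bij_imp_funcset[OF bij] by (auto simp: Pi_iff)
    then show ?thesis
      using that g refl_group_apply[of g x \<tau>] refl_group_apply[of g x "\<rho> \<otimes> \<tau>"] by (simp add: color_act_mult)
  qed
  with bij show "g \<in> Bij E \<and> (\<forall>\<rho>\<in>carrier C. \<forall>p\<in>E. g (color_act C \<rho> p) = color_act C \<rho> (g p))"
    by (auto simp: colored_pts_def)
next
  assume g: "g \<in> Bij E \<and> (\<forall>\<rho>\<in>carrier C. \<forall>p\<in>E. g (color_act C \<rho> p) = color_act C \<rho> (g p))"
  have "g (x, \<rho>) = color_act C \<rho> (g (x, \<one>))" if "x \<in> {1..n}" "\<rho> \<in> carrier C" for x \<rho>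
    using g[THEN conjunct2, rule_format, of \<rho> "(x, \<one>)"] that by simp
  with g show "g \<in> carrier G"
    unfolding carrier_refl_group by blast
qed

lemma refl_group_bij_betw: "g \<in> carrier G \<Longrightarrow> bij_betw g E E"
  using refl_group_Bij by (auto simp: Bij_def)

lemma refl_group_apply_closed: "g \<in> carrier G \<Longrightarrow> p \<in> E \<Longrightarrow> g p \<in> E"
  using refl_group_bij_betw bij_betwE by blast

lemma refl_group_mult:
  "g \<in> carrier G \<Longrightarrow> h \<in> carrier G \<Longrightarrow> g \<otimes>\<^bsub>G\<^esub> h = compose E g h"
proof -
  have "monoid.mult G = (\<lambda>g\<in>Bij E. \<lambda>f\<in>Bij E. compose E g f)"
    unfolding refl_group_def BijGroup_def by simp
  then show "g \<in> carrier G \<Longrightarrow> h \<in> carrier G \<Longrightarrow> g \<otimes>\<^bsub>G\<^esub> h = compose E g h"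
    by (simp add: refl_group_Bij)
qed

lemma refl_group_mult_apply:
  "g \<in> carrier G \<Longrightarrow> h \<in> carrier G \<Longrightarrow> p \<in> E \<Longrightarrow> (g \<otimes>\<^bsub>G\<^esub> h) p = g (h p)"
  by (simp add: refl_group_mult compose_eq)

lemma refl_group_one: "\<one>\<^bsub>G\<^esub> = (\<lambda>p\<in>E. p)"
  by (simp add: refl_group_def BijGroup_def)

lemma refl_group_eqI:
  assumes "g \<in> carrier G" "h \<in> carrier G" and "\<And>x. x \<in> {1..n} \<Longrightarrow> g (x, \<one>) = h (x, \<one>)"
  shows "g = h"
proof (rule extensionalityI)
  show "g \<in> extensional E" "h \<in> extensional E"
    using assms refl_group_Bij Bij_imp_extensional by auto
  show "g p = h p" if "p \<in> E" for p
    using that assms refl_group_apply[of g "fst p" "snd p"] refl_group_apply[of h "fst p" "snd p"]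
    by (cases p) auto
qed

lemma refl_group_compose_closed:
  assumes g: "g \<in> carrier G" and h: "h \<in> carrier G"
  shows "compose E g h \<in> carrier G"
  unfolding carrier_refl_group_iff
proof (intro conjI ballI)
  show "compose E g h \<in> Bij E"
    using g h by (simp add: compose_Bij refl_group_Bij)
  show "compose E g h (color_act C \<rho> p) = color_act C \<rho> (compose E g h p)"
    if "\<rho> \<in> carrier C" "p \<in> E" for \<rho> p
    using that refl_group_apply_closed[OF h that(2)] g h
    by (simp add: compose_eq color_act_closed carrier_refl_group_iff)
qed

lemma refl_group_one_closed: "(\<lambda>p\<in>E. p) \<in> carrier G"
  by (auto simp: carrier_refl_group_iff id_Bij color_act_closed)

lemma refl_group_inv_into_closed:
  assumes g: "g \<in> carrier G"
  shows "(\<lambda>p\<in>E. inv_into E g p) \<in> carrier G"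
  unfolding carrier_refl_group_iff
proof (intro conjI ballI)
  show "(\<lambda>p\<in>E. inv_into E g p) \<in> Bij E"
    using g by (simp add: restrict_inv_into_Bij refl_group_Bij)
  have gE: "g ` E = E" and inj: "inj_on g E"
    using refl_group_bij_betw[OF g] by (auto simp: bij_betw_def)
  fix \<rho> p assume that: "\<rho> \<in> carrier C" "p \<in> E"
  then obtain q where q: "q \<in> E" "p = g q" using gE by blast
  have "color_act C \<rho> p = g (color_act C \<rho> q)"
    using g q that by (simp add: carrier_refl_group_iff)
  moreover have "inv_into E g p = q"
    using q inj by (simp add: inv_into_f_f)
  ultimately show "(\<lambda>p\<in>E. inv_into E g p) (color_act C \<rho> p) =
      color_act C \<rho> ((\<lambda>p\<in>E. inv_into E g p) p)"
    using that q inj color_act_closed[of \<rho> p] color_act_closed[of \<rho> q]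
    by (simp add: inv_into_f_f)
qed

lemma group_refl_group: "group G"
proof (rule groupI)
  show "\<one>\<^bsub>G\<^esub> \<in> carrier G"
    by (simp add: refl_group_one refl_group_one_closed)
next
  fix g h assume "g \<in> carrier G" "h \<in> carrier G"
  then show "g \<otimes>\<^bsub>G\<^esub> h \<in> carrier G"
    by (simp add: refl_group_mult refl_group_compose_closed)
next
  fix g assume g: "g \<in> carrier G"
  show "\<one>\<^bsub>G\<^esub> \<otimes>\<^bsub>G\<^esub> g = g"
    unfolding refl_group_one refl_group_mult[OF refl_group_one_closed g]
    by (intro Id_compose Bij_imp_funcset Bij_imp_extensional refl_group_Bij g)
  have "(\<lambda>p\<in>E. inv_into E g p) \<otimes>\<^bsub>G\<^esub> g = \<one>\<^bsub>G\<^esub>"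
    unfolding refl_group_mult[OF refl_group_inv_into_closed[OF g] g] refl_group_one
    by (intro Bij_compose_restrict_eq refl_group_Bij g)
  with refl_group_inv_into_closed[OF g] show "\<exists>h\<in>carrier G. h \<otimes>\<^bsub>G\<^esub> g = \<one>\<^bsub>G\<^esub>"
    by blast
next
  fix f g h assume "f \<in> carrier G" "g \<in> carrier G" and h: "h \<in> carrier G"
  then show "f \<otimes>\<^bsub>G\<^esub> g \<otimes>\<^bsub>G\<^esub> h = f \<otimes>\<^bsub>G\<^esub> (g \<otimes>\<^bsub>G\<^esub> h)"
    using compose_assoc[OF Bij_imp_funcset[OF refl_group_Bij[OF h]], symmetric]
    by (simp add: refl_group_mult refl_group_compose_closed)
qed

sublocale G: group "refl_group C n"
  by (rule group_refl_group)

lemma finite_refl_group: "finite (carrier G)"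
proof (rule finite_subset)
  show "carrier G \<subseteq> E \<rightarrow>\<^sub>E E"
    using Bij_imp_extensional[of _ E] Bij_imp_funcset[of _ E] refl_group_Bij
    unfolding PiE_def by blast
  show "finite (E \<rightarrow>\<^sub>E E)"
    by (simp add: finite_PiE finite_colored_pts)
qed

section \<open>Elements given by their values at the points of colour 1\<close>

lemma equivariant_ext_apply:
  "x \<in> {1..n} \<Longrightarrow> \<rho> \<in> carrier C \<Longrightarrow> equivariant_ext C n f (x, \<rho>) = color_act C \<rho> (f x)"
  by (simp add: equivariant_ext_def)

text \<open>Distinct positions suffice: the colour of the argument is recovered by cancellation in
  \<open>C\<close>, and an injective self-map of the finite set \<open>E\<close> is
  bijective.\<close>

lemma equivariant_ext_closed:
  assumes inj: "inj_on (fst \<circ> f) {1..n}" and f: "\<And>x. x \<in> {1..n} \<Longrightarrow> f x \<in> E"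
  shows "equivariant_ext C n f \<in> carrier G"
proof -
  let ?g = "equivariant_ext C n f"
  have maps: "?g ` E \<subseteq> E"
  proof (rule image_subsetI)
    show "?g p \<in> E" if "p \<in> E" for p
      using that f[of "fst p"] by (cases p) (auto simp: equivariant_ext_apply color_act_closed)
  qed
  have "inj_on ?g E"
  proof (rule inj_onI)
    fix p q assume p: "p \<in> E" and q: "q \<in> E" and eq: "?g p = ?g q"
    obtain x \<rho> y \<sigma> where [simp]: "p = (x, \<rho>)" "q = (y, \<sigma>)" by fastforce
    have "fst (f x) = fst (f y)" and snd: "\<rho> \<otimes> snd (f x) = \<sigma> \<otimes> snd (f y)"
      using p q eq by (auto simp: equivariant_ext_apply color_act_def)
    then have "x = y"
      using inj_onD[OF inj, of x y] p q by simp
    moreover have "snd (f x) \<in> carrier C"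
      using p f[of x] by (auto simp: colored_pts_def)
    ultimately show "p = q"
      using snd p q right_cancel[of "snd (f y)" \<rho> \<sigma>] by simp
  qed
  with maps have "bij_betw ?g E E"
    by (simp add: bij_betw_def endo_inj_surj finite_colored_pts)
  then have "?g \<in> Bij E"
    by (simp add: Bij_def equivariant_ext_def)
  moreover have "?g (color_act C \<rho> p) = color_act C \<rho> (?g p)" if "\<rho> \<in> carrier C" "p \<in> E" for \<rho> p
    using that f[of "fst p"] by (cases p) (auto simp: equivariant_ext_apply color_act_mult)
  ultimately show ?thesis
    by (simp add: carrier_refl_group_iff)
qed

text \<open>Reduces products in the group to computations at the points (x, 1): the colour produced
  by the inner map passes through the outer one and multiplies from the left.\<close>

lemma equivariant_ext_mult:
  assumes "equivariant_ext C n f \<in> carrier G" "equivariant_ext C n f' \<in> carrier G"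
      "equivariant_ext C n f'' \<in> carrier G"
    and cl: "\<And>x. x \<in> {1..n} \<Longrightarrow> f x \<in> E" "\<And>x. x \<in> {1..n} \<Longrightarrow> f' x \<in> E" "\<And>x. x \<in> {1..n} \<Longrightarrow> f'' x \<in> E"
    and eq: "\<And>x. x \<in> {1..n} \<Longrightarrow> color_act C (snd (f' x)) (f (fst (f' x))) = f'' x"
  shows "equivariant_ext C n f \<otimes>\<^bsub>G\<^esub> equivariant_ext C n f' = equivariant_ext C n f''"
proof (rule refl_group_eqI)
  have one: "color_act C \<one> p = p" if "p \<in> E" for p
    using that by (cases p) simp
  fix x assume x: "x \<in> {1..n}"
  obtain y \<tau> where f': "f' x = (y, \<tau>)" "y \<in> {1..n}" "\<tau> \<in> carrier C"
    using cl(2)[OF x] by (cases "f' x") auto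
  have xE: "(x, \<one>) \<in> E"
    using x by simp
  have "(equivariant_ext C n f \<otimes>\<^bsub>G\<^esub> equivariant_ext C n f') (x, \<one>) =
      equivariant_ext C n f (color_act C \<one> (f' x))"
    using refl_group_mult_apply[OF assms(1,2) xE] equivariant_ext_apply[OF x one_closed] by metis
  also have "\<dots> = equivariant_ext C n f (y, \<tau>)"
    using one[OF cl(2)[OF x]] f'(1) by metis
  also have "\<dots> = f'' x"
    using equivariant_ext_apply[OF f'(2,3), of f] eq[OF x] f'(1) by (metis fst_conv snd_conv)
  also have "\<dots> = equivariant_ext C n f'' (x, \<one>)"
    using one[OF cl(3)[OF x]] equivariant_ext_apply[OF x one_closed] by metis
  finally show "(equivariant_ext C n f \<otimes>\<^bsub>G\<^esub> equivariant_ext C n f') (x, \<one>) =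
      equivariant_ext C n f'' (x, \<one>)" .
qed (rule assms G.m_closed)+

end

subsection \<open>The summands of the shuffle element\<close>

locale card_shuffle = colored_perms C n
  for C :: "('c, 'z) monoid_scheme" (structure) and n :: nat +
  fixes \<gamma> :: 'c
  assumes gen_closed [simp]: "\<gamma> \<in> carrier C"
    and carrier_gen: "carrier C = generate C {\<gamma>}"
    and n_pos: "n \<ge> 1"
begin

abbreviation "m \<equiv> Coset.order C"

lemma m_pos: "m \<ge> 1"
  using finite_colors order_gt_0_iff_finite by simp

lemma gen_pow_bij: "bij_betw (\<lambda>k. \<gamma> [^] k) {..<m} (carrier C)"
proof -
  have ord: "ord \<gamma> = m"
    using generate_pow_card[OF gen_closed] carrier_gen by (simp add: Coset.order_def)
  have "inj_on (\<lambda>k. \<gamma> [^] k) {0..ord \<gamma> - 1}"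
    by (rule ord_inj) simp
  moreover have "{0..ord \<gamma> - 1} = {..<m}"
    using ord m_pos by auto
  ultimately have "inj_on (\<lambda>k. \<gamma> [^] k) {..<m}"
    by simp
  moreover have "(\<lambda>k. \<gamma> [^] k) ` {..<m} = carrier C"
    by (rule card_seteq) (use calculation finite_colors in \<open>auto simp: card_image Coset.order_def\<close>)
  ultimately show ?thesis
    by (simp add: bij_betw_def)
qed

lemma s_elem_closed: "1 \<le> i \<Longrightarrow> i < n \<Longrightarrow> s_elem C n i \<in> carrier G"
  unfolding s_elem_def
  by (rule equivariant_ext_closed) (auto simp: inj_on_def Transposition.transpose_def)

lemma rotation_closed:
  "\<rho> \<in> carrier C \<Longrightarrow> equivariant_ext C n (\<lambda>x. (x, if x = i then \<rho> else \<one>)) \<in> carrier G"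
  by (rule equivariant_ext_closed) (auto simp: inj_on_def)

text \<open>Conjugation by s_i carries the rotation from i to i + 1. The induction starts at 1,
  since \<open>t_elem\<close> has only a placeholder value at 0.\<close>

lemma t_elem_eq:
  assumes "1 \<le> i" "i \<le> n"
  shows "t_elem C \<gamma> n i = equivariant_ext C n (\<lambda>x. (x, if x = i then \<gamma> else \<one>))"
  using assms
proof (induction i rule: nat_induct_at_least)
  case base
  then show ?case by simp
next
  case (Suc i)
  let ?\<pi> = "Transposition.transpose i (i + 1)"
  have perm: "?\<pi> x \<in> {1..n}" if "x \<in> {1..n}" for x
    using that Suc by (auto simp: Transposition.transpose_def)
  have closed: "equivariant_ext C n (\<lambda>x. (?\<pi> x, if x = i then \<gamma> else \<one>)) \<in> carrier G"
    by (rule equivariant_ext_closed) (use perm in \<open>auto simp: inj_on_def dest: transpose_eq_imp_eq\<close>)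
  have s: "equivariant_ext C n (\<lambda>x. (?\<pi> x, \<one>)) \<in> carrier G"
    using s_elem_closed[of i] Suc by (simp add: s_elem_def)
  have st: "s_elem C n i \<otimes>\<^bsub>G\<^esub> t_elem C \<gamma> n i =
      equivariant_ext C n (\<lambda>x. (?\<pi> x, if x = i then \<gamma> else \<one>))"
  proof -
    have "t_elem C \<gamma> n i = equivariant_ext C n (\<lambda>x. (x, if x = i then \<gamma> else \<one>))"
      using Suc by simp
    then show ?thesis
      unfolding s_elem_def
      by (simp only:) (rule equivariant_ext_mult[OF s rotation_closed[OF gen_closed] closed],
        use perm in auto)
  qed
  obtain i' where i': "i = Suc i'"
    using Suc(1) by (cases i) auto
  have "t_elem C \<gamma> n (Suc i) =
      equivariant_ext C n (\<lambda>x. (?\<pi> x, if x = i then \<gamma> else \<one>)) \<otimes>\<^bsub>G\<^esub> s_elem C n i"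
    using st i' by simp
  also have "\<dots> = equivariant_ext C n (\<lambda>x. (x, if x = Suc i then \<gamma> else \<one>))"
    unfolding s_elem_def
    by (rule equivariant_ext_mult[OF closed s rotation_closed[OF gen_closed]])
      (use perm in \<open>auto simp: Transposition.transpose_def\<close>)
  finally show ?case .
qed

lemma t_elem_pow:
  "t_elem C \<gamma> n n [^]\<^bsub>G\<^esub> (k::nat) = equivariant_ext C n (\<lambda>x. (x, if x = n then \<gamma> [^] k else \<one>))"
proof (induction k)
  case 0
  have "equivariant_ext C n (\<lambda>x. (x, \<one>)) = \<one>\<^bsub>G\<^esub>"
    by (rule refl_group_eqI)
      (auto simp: refl_group_one equivariant_ext_apply inj_on_def
        intro!: equivariant_ext_closed refl_group_one_closed)
  then show ?case by (simp cong: if_cong)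
next
  case (Suc k)
  have "t_elem C \<gamma> n n [^]\<^bsub>G\<^esub> Suc k =
      equivariant_ext C n (\<lambda>x. (x, if x = n then \<gamma> [^] k else \<one>)) \<otimes>\<^bsub>G\<^esub>
      equivariant_ext C n (\<lambda>x. (x, if x = n then \<gamma> else \<one>))"
    using Suc t_elem_eq[of n] n_pos by simp
  \<comment> \<open>The colour of the right factor multiplies from the left, so the product comes
    out as \<open>\<gamma>\<close> times \<open>\<gamma> [^] k\<close>, opposite to the recursion of
    the power.\<close>
  also have "\<dots> = equivariant_ext C n (\<lambda>x. (x, if x = n then \<gamma> [^] Suc k else \<one>))"
    by (rule equivariant_ext_mult[OF rotation_closed rotation_closed rotation_closed])
      (use nat_pow_Suc2[OF gen_closed, of k] in auto)
  finally show ?case .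
qed

text \<open>On {1..n} this is the cycle s_j s_(j+1) ... s_(n-1).\<close>

definition cycle_pos :: "nat \<Rightarrow> nat \<Rightarrow> nat"
  where "cycle_pos j x = (if x = n then j else if x < j then x else x + 1)"

lemma inj_on_cycle_pos: "j \<le> n \<Longrightarrow> inj_on (cycle_pos j) {1..n}"
  by (auto simp: inj_on_def cycle_pos_def split: if_splits)

lemma cycle_pos_closed: "1 \<le> j \<Longrightarrow> j \<le> n \<Longrightarrow> x \<in> {1..n} \<Longrightarrow> cycle_pos j x \<in> {1..n}"
  by (auto simp: cycle_pos_def)

lemma cycle_closed:
  assumes "1 \<le> j" "j \<le> n" "\<rho> \<in> carrier C"
  shows "equivariant_ext C n (\<lambda>x. (cycle_pos j x, if x = n then \<rho> else \<one>)) \<in> carrier G"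
  by (rule equivariant_ext_closed)
    (use assms inj_on_cycle_pos[of j] cycle_pos_closed[of j] in \<open>auto simp: comp_def\<close>)

text \<open>Downward induction from the empty product at j = n; the new left factor s_j exchanges
  the values j and j + 1 of \<open>cycle_pos (Suc j)\<close>.\<close>

lemma s_prod_eq:
  assumes "1 \<le> j" "j \<le> n"
  shows "s_prod C n j = equivariant_ext C n (\<lambda>x. (cycle_pos j x, \<one>))"
  using assms(2,1)
proof (induction j rule: inc_induct)
  case base
  have "equivariant_ext C n (\<lambda>x. (cycle_pos n x, \<one>)) = \<one>\<^bsub>G\<^esub>"
    using cycle_closed[of n \<one>] n_pos
    by (intro refl_group_eqI)
      (auto simp: refl_group_one equivariant_ext_apply cycle_pos_def intro!: refl_group_one_closed)
  then show ?case by (simp add: s_prod_def)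
next
  case (step j)
  let ?\<pi> = "Transposition.transpose j (j + 1)"
  have "s_prod C n j = s_elem C n j \<otimes>\<^bsub>G\<^esub> s_prod C n (Suc j)"
    using step by (simp add: s_prod_def upt_conv_Cons)
  also have "\<dots> = equivariant_ext C n (\<lambda>x. (?\<pi> x, \<one>)) \<otimes>\<^bsub>G\<^esub>
      equivariant_ext C n (\<lambda>x. (cycle_pos (Suc j) x, \<one>))"
    using step by (simp add: s_elem_def)
  also have "\<dots> = equivariant_ext C n (\<lambda>x. (cycle_pos j x, \<one>))"
  proof (rule equivariant_ext_mult)
    show "equivariant_ext C n (\<lambda>x. (?\<pi> x, \<one>)) \<in> carrier G"
      using s_elem_closed[of j] step by (simp add: s_elem_def)
    show "equivariant_ext C n (\<lambda>x. (cycle_pos (Suc j) x, \<one>)) \<in> carrier G"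
      using cycle_closed[of "Suc j" \<one>] step by simp
    show "equivariant_ext C n (\<lambda>x. (cycle_pos j x, \<one>)) \<in> carrier G"
      using cycle_closed[of j \<one>] step by simp
  qed (use step in \<open>auto simp: cycle_pos_def Transposition.transpose_def split: if_splits\<close>)
  finally show ?case .
qed

text \<open>As a move on arrangements: the bottom card, at position n, is rotated by
  \<open>\<gamma> [^] k\<close> and put at position j.\<close>

definition insertion :: "nat \<Rightarrow> nat \<Rightarrow> nat \<times> 'c \<Rightarrow> nat \<times> 'c"
  where "insertion j k = s_prod C n j \<otimes>\<^bsub>G\<^esub> t_elem C \<gamma> n n [^]\<^bsub>G\<^esub> k"

lemma insertion_eq:
  assumes "1 \<le> j" "j \<le> n"
  shows "insertion j k =
    equivariant_ext C n (\<lambda>x. (cycle_pos j x, if x = n then \<gamma> [^] k else \<one>))"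
  unfolding insertion_def s_prod_eq[OF assms] t_elem_pow
  by (rule equivariant_ext_mult)
    (use assms cycle_closed[of j \<one>] cycle_closed[of j "\<gamma> [^] k"] rotation_closed[of "\<gamma> [^] k" n]
      cycle_pos_closed[of j] in auto)

lemma s_prod_closed: "j \<in> {1..n} \<Longrightarrow> s_prod C n j \<in> carrier G"
  using cycle_closed[of j \<one>] by (simp add: s_prod_eq)

lemma t_elem_pow_closed: "t_elem C \<gamma> n n [^]\<^bsub>G\<^esub> (k::nat) \<in> carrier G"
  using rotation_closed[of "\<gamma> [^] k" n] by (simp add: t_elem_pow)

lemma insertion_closed: "j \<in> {1..n} \<Longrightarrow> insertion j k \<in> carrier G"
  by (simp add: insertion_def s_prod_closed t_elem_pow_closed)

lemma insertion_mult_apply: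
  assumes "j \<in> {1..n}" "h \<in> carrier G" "x \<in> {1..n}" "h (x, \<one>) = (q, \<sigma>)"
  shows "(insertion j k \<otimes>\<^bsub>G\<^esub> h) (x, \<one>) = (cycle_pos j q, \<sigma> \<otimes> (if q = n then \<gamma> [^] k else \<one>))"
proof -
  have "(x, \<one>) \<in> E"
    using assms(3) by simp
  then have "(q, \<sigma>) \<in> E"
    using refl_group_apply_closed[OF assms(2)] assms(4) by metis
  then show ?thesis
    using assms refl_group_mult_apply[OF insertion_closed[OF assms(1)] assms(2) \<open>(x, \<one>) \<in> E\<close>, of k]
    by (simp add: insertion_eq equivariant_ext_apply)
qed

end

text \<open>Only the pair (g h^-1, h) contributes to the convolution sum.\<close>

lemma (in group) grp_ring_mult_grp_basis:
  assumes fin: "finite (carrier G)" and h: "h \<in> carrier G" and g: "g \<in> carrier G"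
  shows "grp_ring_mult G a (grp_basis h) g = a (g \<otimes> inv h)"
proof -
  let ?A = "{(x, k) \<in> carrier G \<times> carrier G. x \<otimes> k = g}"
  have "finite ?A"
    by (rule finite_subset[of _ "carrier G \<times> carrier G"]) (use fin in auto)
  have "grp_ring_mult G a (grp_basis h) g =
      (\<Sum>p\<in>?A. if p = (g \<otimes> inv h, h) then a (g \<otimes> inv h) else 0)"
    unfolding grp_ring_mult_def
  proof (rule sum.cong)
    fix p assume "p \<in> ?A"
    then obtain x k where p: "p = (x, k)" "x \<in> carrier G" "k \<in> carrier G" "x \<otimes> k = g"
      by blast
    then have "k = h \<longrightarrow> x = g \<otimes> inv h"
      using h by (auto simp: m_assoc)
    then show "(case p of (x, k) \<Rightarrow> a x * grp_basis h k) =
        (if p = (g \<otimes> inv h, h) then a (g \<otimes> inv h) else 0)"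
      by (auto simp: p(1) grp_basis_def)
  qed simp
  also have "\<dots> = a (g \<otimes> inv h)"
    using \<open>finite ?A\<close> g h by (simp add: sum.delta' m_assoc)
  finally show ?thesis .
qed

lemma (in group) grp_ring_mult_sum_basis:
  assumes fin: "finite (carrier G)"
    and u: "\<And>j. j \<in> J \<Longrightarrow> u j \<in> carrier G" and v: "\<And>k. k \<in> K \<Longrightarrow> v k \<in> carrier G"
  shows "grp_ring_mult G (\<lambda>g. \<Sum>j\<in>J. grp_basis (u j) g) (\<lambda>g. \<Sum>k\<in>K. grp_basis (v k) g) x =
    (\<Sum>j\<in>J. \<Sum>k\<in>K. of_bool (u j \<otimes> v k = x))"
proof -
  let ?A = "{(h, k) \<in> carrier G \<times> carrier G. h \<otimes> k = x}"
  have "finite ?A"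
    by (rule finite_subset[of _ "carrier G \<times> carrier G"]) (use fin in auto)
  have "grp_ring_mult G (\<lambda>g. \<Sum>j\<in>J. grp_basis (u j) g) (\<lambda>g. \<Sum>k\<in>K. grp_basis (v k) g) x =
      (\<Sum>p\<in>?A. \<Sum>j\<in>J. \<Sum>k\<in>K. if p = (u j, v k) then 1 else 0)"
    unfolding grp_ring_mult_def
    by (intro sum.cong refl) (auto simp: sum_product grp_basis_def intro!: sum.cong)
  also have "\<dots> = (\<Sum>j\<in>J. \<Sum>p\<in>?A. \<Sum>k\<in>K. if p = (u j, v k) then 1 else 0)"
    by (rule sum.swap)
  also have "\<dots> = (\<Sum>j\<in>J. \<Sum>k\<in>K. \<Sum>p\<in>?A. if p = (u j, v k) then 1 else 0)"
    by (intro sum.cong refl sum.swap)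
  also have "\<dots> = (\<Sum>j\<in>J. \<Sum>k\<in>K. of_bool (u j \<otimes> v k = x))"
    using u v \<open>finite ?A\<close> by (intro sum.cong refl) (simp add: sum.delta')
  finally show ?thesis .
qed

subsection \<open>The shuffle operator\<close>

context card_shuffle
begin

lemma shuffle_matrix_eq:
  assumes "g \<in> carrier G" "h \<in> carrier G"
  shows "shuffle_matrix C \<gamma> n g h =
    (\<Sum>j=1..n. \<Sum>k<m. of_bool (insertion j k \<otimes>\<^bsub>G\<^esub> h = g)) / (real m * real n)"
proof -
  have iff: "insertion j k = g \<otimes>\<^bsub>G\<^esub> inv\<^bsub>G\<^esub> h \<longleftrightarrow> insertion j k \<otimes>\<^bsub>G\<^esub> h = g"
    if "j \<in> {1..n}" for j k
    using G.inv_solve_right[OF insertion_closed[OF that, of k] assms] by blast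
  have "Sh C \<gamma> n x = (\<Sum>j=1..n. \<Sum>k<m. of_bool (insertion j k = x))" for x
    unfolding Sh_def insertion_def
    by (rule G.grp_ring_mult_sum_basis[OF finite_refl_group s_prod_closed t_elem_pow_closed])
  then have "grp_ring_mult G (Sh C \<gamma> n) (grp_basis h) g =
      (\<Sum>j=1..n. \<Sum>k<m. of_bool (insertion j k = g \<otimes>\<^bsub>G\<^esub> inv\<^bsub>G\<^esub> h))"
    using G.grp_ring_mult_grp_basis[OF finite_refl_group assms(2,1)] by simp
  also have "\<dots> = (\<Sum>j=1..n. \<Sum>k<m. of_bool (insertion j k \<otimes>\<^bsub>G\<^esub> h = g))"
    by (intro sum.cong refl) (simp add: iff)
  finally show ?thesis
    unfolding shuffle_matrix_def by simp
qed

text \<open>For every pair (j, k) exactly one \<open>h\<close> is carried to \<open>g\<close>. As an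
  operator on functions the matrix thus averages over the m n ways to undo one shuffle.\<close>

lemma shuffle_matrix_sum:
  fixes F :: "(nat \<times> 'c \<Rightarrow> nat \<times> 'c) \<Rightarrow> real"
  assumes g: "g \<in> carrier G"
  shows "(\<Sum>h\<in>carrier G. shuffle_matrix C \<gamma> n g h * F h) =
    (\<Sum>j=1..n. \<Sum>k<m. F (inv\<^bsub>G\<^esub> (insertion j k) \<otimes>\<^bsub>G\<^esub> g)) / (real m * real n)"
proof -
  have iff: "insertion j k \<otimes>\<^bsub>G\<^esub> h = g \<longleftrightarrow> h = inv\<^bsub>G\<^esub> (insertion j k) \<otimes>\<^bsub>G\<^esub> g"
    if "j \<in> {1..n}" "h \<in> carrier G" for j k h
    using G.inv_solve_left[OF that(2) insertion_closed[OF that(1), of k] g] by metis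
  have "(\<Sum>h\<in>carrier G. shuffle_matrix C \<gamma> n g h * F h) =
      (\<Sum>h\<in>carrier G. \<Sum>j=1..n. \<Sum>k<m. of_bool (insertion j k \<otimes>\<^bsub>G\<^esub> h = g) * F h) / (real m * real n)"
    using g by (simp add: shuffle_matrix_eq sum_distrib_right sum_divide_distrib)
  also have "(\<Sum>h\<in>carrier G. \<Sum>j=1..n. \<Sum>k<m. of_bool (insertion j k \<otimes>\<^bsub>G\<^esub> h = g) * F h) =
      (\<Sum>j=1..n. \<Sum>h\<in>carrier G. \<Sum>k<m. of_bool (insertion j k \<otimes>\<^bsub>G\<^esub> h = g) * F h)"
    by (rule sum.swap)
  also have "\<dots> = (\<Sum>j=1..n. \<Sum>k<m. \<Sum>h\<in>carrier G. of_bool (insertion j k \<otimes>\<^bsub>G\<^esub> h = g) * F h)"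
    by (intro sum.cong refl sum.swap)
  also have "\<dots> = (\<Sum>j=1..n. \<Sum>k<m. F (inv\<^bsub>G\<^esub> (insertion j k) \<otimes>\<^bsub>G\<^esub> g))"
  proof (intro sum.cong refl)
    fix j k assume j: "j \<in> {1..n}"
    let ?h = "inv\<^bsub>G\<^esub> (insertion j k) \<otimes>\<^bsub>G\<^esub> g"
    have "(\<Sum>h\<in>carrier G. of_bool (insertion j k \<otimes>\<^bsub>G\<^esub> h = g) * F h) =
        (\<Sum>h\<in>carrier G. if h = ?h then F h else 0)"
      by (intro sum.cong refl) (simp add: iff[OF j])
    also have "\<dots> = F ?h"
      using insertion_closed[OF j] g finite_refl_group by (simp add: sum.delta')
    finally show "(\<Sum>h\<in>carrier G. of_bool (insertion j k \<otimes>\<^bsub>G\<^esub> h = g) * F h) = F ?h" .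
  qed
  finally show ?thesis .
qed

text \<open>Regard \<open>g\<close> as an arrangement in which card \<open>x\<close> lies at position \<open>fst (g (x, 1))\<close>, rotated by
  \<open>snd (g (x, 1))\<close>: \<open>keeps b g\<close> says that the cards \<open>1, \<dots>, b\<close> are unrotated and in their
  original relative order.\<close>

definition keeps :: "nat \<Rightarrow> (nat \<times> 'c \<Rightarrow> nat \<times> 'c) \<Rightarrow> bool"
  where "keeps b g \<longleftrightarrow> (\<forall>x\<in>{1..b}. snd (g (x, \<one>)) = \<one>) \<and>
    strict_mono_on {1..b} (\<lambda>x. fst (g (x, \<one>)))"

lemma keeps_cong:
  assumes "\<And>x. x \<in> {1..b} \<Longrightarrow> snd (g (x, \<one>)) = snd (h (x, \<one>))"
    and "\<And>x y. x \<in> {1..b} \<Longrightarrow> y \<in> {1..b} \<Longrightarrow>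
      fst (g (x, \<one>)) < fst (g (y, \<one>)) \<longleftrightarrow> fst (h (x, \<one>)) < fst (h (y, \<one>))"
  shows "keeps b g \<longleftrightarrow> keeps b h"
proof -
  have "strict_mono_on {1..b} (\<lambda>x. fst (g (x, \<one>))) \<longleftrightarrow> strict_mono_on {1..b} (\<lambda>x. fst (h (x, \<one>)))"
    unfolding strict_mono_on_def using assms(2) by blast
  moreover have "(\<forall>x\<in>{1..b}. snd (g (x, \<one>)) = \<one>) \<longleftrightarrow> (\<forall>x\<in>{1..b}. snd (h (x, \<one>)) = \<one>)"
    using assms(1) by simp
  ultimately show ?thesis
    unfolding keeps_def by blast
qed

lemma keeps_Suc:
  "keeps (Suc b) g \<longleftrightarrow> keeps b g \<and> snd (g (Suc b, \<one>)) = \<one> \<and>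
    (\<forall>x\<in>{1..b}. fst (g (x, \<one>)) < fst (g (Suc b, \<one>)))"
proof -
  have "{1..Suc b} = insert (Suc b) {1..b}"
    by auto
  moreover have "strict_mono_on (insert (Suc b) {1..b}) f \<longleftrightarrow>
      strict_mono_on {1..b} f \<and> (\<forall>x\<in>{1..b}. f x < f (Suc b))" for f :: "nat \<Rightarrow> nat"
    unfolding strict_mono_on_def by auto
  ultimately show ?thesis
    unfolding keeps_def by auto
qed

lemma keeps_0 [simp]: "keeps 0 g"
  by (simp add: keeps_def)

lemma position_closed: "g \<in> carrier G \<Longrightarrow> x \<in> {1..n} \<Longrightarrow> fst (g (x, \<one>)) \<in> {1..n}"
  using refl_group_apply_closed[of g "(x, \<one>)"] by (cases "g (x, \<one>)") auto

lemma color_closed: "g \<in> carrier G \<Longrightarrow> x \<in> {1..n} \<Longrightarrow> snd (g (x, \<one>)) \<in> carrier C"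
  using refl_group_apply_closed[of g "(x, \<one>)"] by (cases "g (x, \<one>)") auto

text \<open>If x and y shared a position, a suitable colour on x would give it the same image in
  \<open>E\<close> as (y, 1), against injectivity of \<open>g\<close>.\<close>

lemma position_bij:
  assumes g: "g \<in> carrier G"
  shows "bij_betw (\<lambda>x. fst (g (x, \<one>))) {1..n} {1..n}"
proof -
  have "inj_on (\<lambda>x. fst (g (x, \<one>))) {1..n}"
  proof (rule inj_onI)
    fix x y assume x: "x \<in> {1..n}" and y: "y \<in> {1..n}" and eq: "fst (g (x, \<one>)) = fst (g (y, \<one>))"
    let ?\<rho> = "snd (g (x, \<one>))" and ?\<sigma> = "snd (g (y, \<one>))"
    have cl: "?\<rho> \<in> carrier C" "?\<sigma> \<in> carrier C"
      using color_closed[OF g] x y by blast+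
    have "g (x, ?\<sigma> \<otimes> inv ?\<rho>) = color_act C (?\<sigma> \<otimes> inv ?\<rho>) (g (x, \<one>))"
      by (rule refl_group_apply[OF g x]) (use cl in simp)
    also have "\<dots> = g (y, \<one>)"
      using eq cl by (simp add: color_act_def m_assoc prod_eq_iff)
    finally have geq: "g (x, ?\<sigma> \<otimes> inv ?\<rho>) = g (y, \<one>)" .
    have "inj_on g E"
      using refl_group_bij_betw[OF g] by (simp add: bij_betw_def)
    moreover note geq
    moreover have "(x, ?\<sigma> \<otimes> inv ?\<rho>) \<in> E" "(y, \<one>) \<in> E"
      using x y cl by simp_all
    ultimately have "(x, ?\<sigma> \<otimes> inv ?\<rho>) = (y, \<one>)"
      by (rule inj_onD)
    then show "x = y" by simp
  qed
  moreover have "(\<lambda>x. fst (g (x, \<one>))) ` {1..n} \<subseteq> {1..n}"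
    using position_closed[OF g] by blast
  ultimately show ?thesis
    unfolding bij_betw_def by (simp add: endo_inj_surj)
qed

text \<open>On the positions before n the cycle only opens a gap at j, so the cards that are not
  moved keep their order.\<close>

lemma cycle_pos_less_iff:
  "q < n \<Longrightarrow> q' < n \<Longrightarrow> cycle_pos j q < cycle_pos j q' \<longleftrightarrow> q < q'"
  by (auto simp: cycle_pos_def)

section \<open>Taking the card \<open>y\<close> back to the bottom position n\<close>

context
  fixes g h y k
  assumes h: "h \<in> carrier G" and y: "y \<in> {1..n}"
    and g: "insertion (fst (g (y, \<one>))) k \<otimes>\<^bsub>G\<^esub> h = g"
    and j: "fst (g (y, \<one>)) \<in> {1..n}"
begin

lemma removal_apply:
  assumes "x \<in> {1..n}"
  shows "fst (g (x, \<one>)) = cycle_pos (fst (g (y, \<one>))) (fst (h (x, \<one>)))"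
    and "snd (g (x, \<one>)) = snd (h (x, \<one>)) \<otimes> (if fst (h (x, \<one>)) = n then \<gamma> [^] k else \<one>)"
  using insertion_mult_apply[OF j h assms, of "fst (h (x, \<one>))" "snd (h (x, \<one>))" k] g
  by (simp_all add: prod_eq_iff)

lemma removal_position: "fst (h (y, \<one>)) = n"
proof -
  have "cycle_pos (fst (g (y, \<one>))) (fst (h (y, \<one>))) = cycle_pos (fst (g (y, \<one>))) n"
    using removal_apply(1)[OF y] by (simp add: cycle_pos_def)
  then show ?thesis
    by (rule inj_onD[OF inj_on_cycle_pos, rotated])
      (use j position_closed[OF h y] n_pos in simp_all)
qed

lemma removal_color: "snd (g (y, \<one>)) = snd (h (y, \<one>)) \<otimes> \<gamma> [^] k"
  using removal_apply(2)[OF y] removal_position by simp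

lemma removal_position_other: "x \<in> {1..n} \<Longrightarrow> x \<noteq> y \<Longrightarrow> fst (h (x, \<one>)) < n"
  using inj_onD[OF bij_betw_imp_inj_on[OF position_bij[OF h]], of x y]
    position_closed[OF h, of x] y removal_position
  by (force simp: le_less)

lemma keeps_removal: "b \<le> n \<Longrightarrow> b < y \<Longrightarrow> keeps b h \<longleftrightarrow> keeps b g"
  using removal_position_other color_closed[OF h]
  by (intro keeps_cong) (simp_all add: removal_apply cycle_pos_less_iff less_imp_neq)

lemma keeps_removal_eq_0:
  assumes "b \<le> n" "y < b"
  shows "\<not> keeps b h"
proof
  assume "keeps b h"
  then have "strict_mono_on {1..b} (\<lambda>x. fst (h (x, \<one>)))"
    by (simp add: keeps_def)
  then have "fst (h (y, \<one>)) < fst (h (b, \<one>))"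
    by (rule strict_mono_onD) (use assms y in auto)
  then show False
    using removal_position position_closed[OF h, of b] assms by simp
qed

text \<open>In \<open>h\<close> the card b + 1 lies at position n, after all others, so only its
  colour is a condition; it is trivial in \<open>h\<close> exactly when it is
  \<open>\<gamma> [^] k\<close> in \<open>g\<close>.\<close>

lemma keeps_removal_last:
  assumes "y = Suc b"
  shows "keeps (Suc b) h \<longleftrightarrow> keeps b g \<and> snd (g (y, \<one>)) = \<gamma> [^] k"
proof -
  have "snd (g (y, \<one>)) = \<gamma> [^] k \<longleftrightarrow> snd (h (y, \<one>)) = \<one>"
    using removal_color color_closed[OF h y] by simp
  then show ?thesis
    using assms y removal_position removal_position_other keeps_removal[of b]
    by (auto simp: keeps_Suc)
qed

end

text \<open>Each summand undoes one shuffle: the card \<open>y\<close> at position \<open>j\<close> returns to the bottom,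
  rotated back by \<open>\<gamma>\<^sup>k\<close>. This leaves the cards \<open>1, \<dots>, b\<close> alone if \<open>y > b\<close>; if \<open>y = b\<close>, exactly one
  \<open>k\<close> makes its colour trivial; and if \<open>y < b\<close>, it ends up below card \<open>b\<close>.\<close>

lemma sum_keeps_removal:
  assumes g: "g \<in> carrier G" and b: "b \<le> n"
  shows "(\<Sum>j=1..n. \<Sum>k<m. of_bool (keeps b (inv\<^bsub>G\<^esub> (insertion j k) \<otimes>\<^bsub>G\<^esub> g))) =
    real m * real (n - b) * of_bool (keeps b g) + (if b = 0 then 0 else of_bool (keeps (b - 1) g))"
proof -
  let ?p = "\<lambda>x. fst (g (x, \<one>))"
  let ?h = "\<lambda>y k. inv\<^bsub>G\<^esub> (insertion (?p y) k) \<otimes>\<^bsub>G\<^esub> g"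
  have h: "?h y k \<in> carrier G" "insertion (?p y) k \<otimes>\<^bsub>G\<^esub> ?h y k = g" if "y \<in> {1..n}" for y k
    using insertion_closed[OF position_closed[OF g that], of k] g
    by (simp_all add: G.m_assoc[symmetric])
  \<comment> \<open>The sum over positions j becomes a sum over the card y that \<open>g\<close> has
    at position j.\<close>
  have "(\<Sum>j=1..n. \<Sum>k<m. of_bool (keeps b (inv\<^bsub>G\<^esub> (insertion j k) \<otimes>\<^bsub>G\<^esub> g))) =
      (\<Sum>y=1..n. \<Sum>k<m. of_bool (keeps b (?h y k)) :: real)"
    by (rule sum.reindex_bij_betw[OF position_bij[OF g], symmetric])
  also have "\<dots> = (\<Sum>y=1..n. if b < y then real m * of_bool (keeps b g)
      else if y = b then of_bool (keeps (b - 1) g) else 0)"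
  proof (intro sum.cong refl)
    fix y assume y: "y \<in> {1..n}"
    consider "b < y" | "y = b" | "y < b" by linarith
    then show "(\<Sum>k<m. of_bool (keeps b (?h y k)) :: real) =
        (if b < y then real m * of_bool (keeps b g)
         else if y = b then of_bool (keeps (b - 1) g) else 0)"
    proof cases
      case 1
      then show ?thesis
        using keeps_removal[OF h(1)[OF y] y h(2)[OF y] position_closed[OF g y] b] by simp
    next
      case 2
      then obtain c where c: "y = Suc c" "b = Suc c"
        using y by (cases y) auto
      have "(\<Sum>k<m. of_bool (keeps b (?h y k)) :: real) =
          of_bool (keeps c g) * (\<Sum>k<m. of_bool (snd (g (y, \<one>)) = \<gamma> [^] k))"
        unfolding sum_distrib_left
        using keeps_removal_last[OF h(1)[OF y] y h(2)[OF y] position_closed[OF g y] c(1)] c(2)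
        by (intro sum.cong refl) simp
      also have "(\<Sum>k<m. of_bool (snd (g (y, \<one>)) = \<gamma> [^] k) :: real) =
          (\<Sum>\<rho>\<in>carrier C. of_bool (snd (g (y, \<one>)) = \<rho>))"
        by (rule sum.reindex_bij_betw[OF gen_pow_bij])
      also have "\<dots> = 1"
        using color_closed[OF g y] finite_colors by (simp add: of_bool_def sum.delta)
      finally show ?thesis
        using c by simp
    next
      case 3
      then show ?thesis
        using keeps_removal_eq_0[OF h(1)[OF y] y h(2)[OF y] position_closed[OF g y] b] by simp
    qed
  qed
  also have "\<dots> = (\<Sum>y=1..n. (if b < y then real m * of_bool (keeps b g) else 0) +
      (if y = b then of_bool (keeps (b - 1) g) else 0))"
    by (intro sum.cong) auto
  also have "\<dots> = (\<Sum>y=1..n. if b < y then real m * of_bool (keeps b g) else 0) +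
      (if b = 0 then 0 else of_bool (keeps (b - 1) g))"
    using b by (simp add: sum.distrib sum.delta')
  also have "(\<Sum>y=1..n. if b < y then real m * of_bool (keeps b g) else 0) =
      (\<Sum>y\<in>{b<..n}. real m * of_bool (keeps b g))"
    by (rule sum.mono_neutral_cong_right) auto
  finally show ?thesis
    by (simp add: algebra_simps)
qed

text \<open>Left multiplication commutes with right translation by \<open>f\<close>. Taking for
  \<open>f\<close> the inverse of j serves column j of the powers; \<open>f\<close> = 1 serves the
  row sums and the eigenvector.\<close>

lemma shuffle_matrix_keeps:
  assumes g: "g \<in> carrier G" and f: "f \<in> carrier G" and b: "b \<le> n"
  shows "(\<Sum>h\<in>carrier G. shuffle_matrix C \<gamma> n g h * of_bool (keeps b (h \<otimes>\<^bsub>G\<^esub> f))) =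
    real (n - b) / real n * of_bool (keeps b (g \<otimes>\<^bsub>G\<^esub> f)) +
    (if b = 0 then 0 else of_bool (keeps (b - 1) (g \<otimes>\<^bsub>G\<^esub> f)) / (real m * real n))"
proof -
  have "inv\<^bsub>G\<^esub> (insertion j k) \<otimes>\<^bsub>G\<^esub> g \<otimes>\<^bsub>G\<^esub> f = inv\<^bsub>G\<^esub> (insertion j k) \<otimes>\<^bsub>G\<^esub> (g \<otimes>\<^bsub>G\<^esub> f)"
    if "j \<in> {1..n}" for j k
    using insertion_closed[OF that] f g by (simp add: G.m_assoc)
  then have "(\<Sum>h\<in>carrier G. shuffle_matrix C \<gamma> n g h * of_bool (keeps b (h \<otimes>\<^bsub>G\<^esub> f))) =
    (\<Sum>j=1..n. \<Sum>k<m. of_bool (keeps b (inv\<^bsub>G\<^esub> (insertion j k) \<otimes>\<^bsub>G\<^esub> (g \<otimes>\<^bsub>G\<^esub> f)))) / (real m * real n)"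
    unfolding shuffle_matrix_sum[OF g] by simp
  also have "\<dots> = (real m * real (n - b) * of_bool (keeps b (g \<otimes>\<^bsub>G\<^esub> f)) +
      (if b = 0 then 0 else of_bool (keeps (b - 1) (g \<otimes>\<^bsub>G\<^esub> f)))) / (real m * real n)"
    using sum_keeps_removal[of "g \<otimes>\<^bsub>G\<^esub> f" b] f g b by simp
  finally show ?thesis
    using m_pos by (simp add: add_divide_distrib)
qed

end

subsection \<open>Stirling numbers\<close>

text \<open>Both sides count the maps from a k-set to an x-set, the left one by the size a of the
  image. The induction splits the factor x as a + (x - a).\<close>

lemma sum_Stirling_ffact:
  "(\<Sum>a\<le>x. real (Stirling k a) * (fact x / fact (x - a))) = real x ^ k"
proof (induction k)
  case 0
  have "(\<Sum>a\<le>x. real (Stirling 0 a) * (fact x / fact (x - a))) = (\<Sum>a\<le>x. if a = 0 then 1 else 0)"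
  proof (rule sum.cong)
    fix a show "real (Stirling 0 a) * (fact x / fact (x - a)) = (if a = 0 then 1 else 0)"
      by (cases a) simp_all
  qed simp
  then show ?case by simp
next
  case (Suc k)
  define f :: "nat \<Rightarrow> real" where "f a = fact x / fact (x - a)" for a
  have f_Suc: "f (Suc a) = f a * (real x - real a)" if "a < x" for a
  proof -
    have "x - a = Suc (x - Suc a)" using that by simp
    then have "(fact (x - a) :: real) = (real x - real a) * fact (x - Suc a)"
      using that by (simp add: fact_Suc of_nat_diff)
    moreover have "real x - real a \<noteq> 0"
      using that by simp
    ultimately show ?thesis
      by (simp add: f_def)
  qed
  have "(\<Sum>a\<le>x. real (Stirling (Suc k) a) * f a) = (\<Sum>a<x. real (Stirling (Suc k) (Suc a)) * f (Suc a))"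
    by (subst sum.atMost_shift) simp
  also have "\<dots> = (\<Sum>a<x. real (Suc a) * real (Stirling k (Suc a)) * f (Suc a)) +
      (\<Sum>a<x. real (Stirling k a) * f a * (real x - real a))"
    unfolding sum.distrib[symmetric]
    by (intro sum.cong refl) (simp add: f_Suc algebra_simps)
  also have "(\<Sum>a<x. real (Suc a) * real (Stirling k (Suc a)) * f (Suc a)) =
      (\<Sum>a\<le>x. real a * real (Stirling k a) * f a)"
    by (subst sum.atMost_shift) simp
  \<comment> \<open>The added term a = x vanishes because of the factor x - a.\<close>
  also have "(\<Sum>a<x. real (Stirling k a) * f a * (real x - real a)) =
      (\<Sum>a\<le>x. real (Stirling k a) * f a * (real x - real a))"
    by (simp add: lessThan_Suc_atMost[symmetric])
  also have "(\<Sum>a\<le>x. real a * real (Stirling k a) * f a) +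
      (\<Sum>a\<le>x. real (Stirling k a) * f a * (real x - real a)) = real x * (\<Sum>a\<le>x. real (Stirling k a) * f a)"
    unfolding sum.distrib[symmetric] sum_distrib_left
    by (intro sum.cong refl) (simp add: algebra_simps)
  finally show ?case
    using Suc by (simp add: f_def)
qed

text \<open>In the preceding expansion of a^k the last term is S(k, a) a!.\<close>

lemma Stirling_le_power: "real (Stirling k a) \<le> real a ^ k"
proof -
  have "real (Stirling k a) * 1 \<le> real (Stirling k a) * (fact a / fact (a - a))"
    by (intro mult_left_mono) (simp_all add: fact_ge_1)
  also have "\<dots> \<le> (\<Sum>b\<le>a. real (Stirling k b) * (fact a / fact (a - b)))"
    by (rule member_le_sum) simp_all
  finally show ?thesis
    by (simp only: sum_Stirling_ffact mult_1_right)
qed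

subsection \<open>Finite Markov chains\<close>

lemma sum_mat_pow_eigenvector:
  fixes v :: "'a \<Rightarrow> complex"
  assumes "finite S" and v: "\<And>i. i \<in> S \<Longrightarrow> (\<Sum>j\<in>S. complex_of_real (P i j) * v j) = z * v i"
    and "i \<in> S"
  shows "(\<Sum>j\<in>S. complex_of_real (mat_pow S P k i j) * v j) = z ^ k * v i"
  using \<open>i \<in> S\<close>
proof (induction k arbitrary: i)
  case 0
  have "(\<Sum>j\<in>S. complex_of_real (mat_pow S P 0 i j) * v j) = (\<Sum>j\<in>S. if i = j then v j else 0)"
    by (intro sum.cong refl) simp
  then show ?case
    using \<open>finite S\<close> 0 by (simp add: sum.delta)
next
  case (Suc k)
  have "(\<Sum>j\<in>S. complex_of_real (mat_pow S P (Suc k) i j) * v j) =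
      (\<Sum>j\<in>S. \<Sum>l\<in>S. complex_of_real (P i l) * (complex_of_real (mat_pow S P k l j) * v j))"
    by (simp add: sum_distrib_right mult.assoc)
  also have "\<dots> = (\<Sum>l\<in>S. complex_of_real (P i l) * (\<Sum>j\<in>S. complex_of_real (mat_pow S P k l j) * v j))"
    by (subst sum.swap) (simp add: sum_distrib_left)
  also have "\<dots> = z ^ k * (\<Sum>l\<in>S. complex_of_real (P i l) * v l)"
    unfolding sum_distrib_left[of "z ^ k"] by (intro sum.cong refl) (simp add: Suc.IH)
  finally show ?case
    using v[OF Suc.prems] by simp
qed

lemma tendsto_le_power_imp_nonpos:
  fixes a :: real
  assumes "\<And>k. k \<ge> 1 \<Longrightarrow> a \<le> B * q ^ k" "0 \<le> q" "q < 1"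
  shows "a \<le> 0"
proof (rule LIMSEQ_le_const)
  show "(\<lambda>k. B * q ^ k) \<longlonglongrightarrow> 0"
    using assms by (intro tendsto_mult_right_zero LIMSEQ_realpow_zero)
  show "\<exists>N. \<forall>k\<ge>N. a \<le> B * q ^ k"
    using assms(1) by blast
qed

text \<open>The constant \<open>u\<close> cancels against vectors of coordinate sum 0; this is how
  the mixing bound is turned into statements about eigenvectors.\<close>

locale geometric_mixing =
  fixes S :: "'a set" and P :: "'a \<Rightarrow> 'a \<Rightarrow> real" and u \<alpha> r :: real
  assumes finite_states: "finite S" and states_nonempty: "S \<noteq> {}"
    and stochastic: "doubly_stochastic S P"
    and mixing: "\<And>k i j. k \<ge> 1 \<Longrightarrow> i \<in> S \<Longrightarrow> j \<in> S \<Longrightarrow> \<bar>mat_pow S P k i j - u\<bar> \<le> \<alpha> * r ^ k"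
    and rate: "0 \<le> r" "r < 1"
begin

lemma row_sum: "i \<in> S \<Longrightarrow> (\<Sum>j\<in>S. P i j) = 1"
  and column_sum: "j \<in> S \<Longrightarrow> (\<Sum>i\<in>S. P i j) = 1"
  using stochastic by (auto simp: doubly_stochastic_def)

text \<open>On v the matrix P^k acts as z^k, and subtracting \<open>u\<close> from all entries
  changes nothing. Divide the resulting estimate by |z|^k and let k grow.\<close>

lemma eigenvector_sum_0:
  fixes v :: "'a \<Rightarrow> complex"
  assumes v: "\<And>i. i \<in> S \<Longrightarrow> (\<Sum>j\<in>S. complex_of_real (P i j) * v j) = z * v i"
    and sum_0: "(\<Sum>j\<in>S. v j) = 0" and z: "r < cmod z" and i: "i \<in> S"
  shows "v i = 0"
proof -
  let ?B = "\<Sum>j\<in>S. cmod (v j)"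
  have "cmod (v i) \<le> (\<alpha> * ?B) * (r / cmod z) ^ k" if k: "k \<ge> 1" for k
  proof -
    have "z ^ k * v i = (\<Sum>j\<in>S. complex_of_real (mat_pow S P k i j - u) * v j)"
      using sum_mat_pow_eigenvector[OF finite_states v i, where k = k] sum_0
      by (simp add: algebra_simps sum_subtractf sum_distrib_right[symmetric] sum_distrib_left[symmetric])
    then have "cmod z ^ k * cmod (v i) = cmod (\<Sum>j\<in>S. complex_of_real (mat_pow S P k i j - u) * v j)"
      unfolding norm_mult[of "z ^ k" "v i", unfolded norm_power, symmetric] by (rule arg_cong)
    also have "\<dots> \<le> (\<Sum>j\<in>S. cmod (complex_of_real (mat_pow S P k i j - u) * v j))"
      by (rule norm_sum)
    also have "\<dots> \<le> (\<Sum>j\<in>S. \<alpha> * r ^ k * cmod (v j))"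
      unfolding norm_mult norm_of_real
      by (intro sum_mono mult_right_mono mixing k i) auto
    finally have "cmod z ^ k * cmod (v i) \<le> \<alpha> * ?B * r ^ k"
      by (simp add: sum_distrib_left[symmetric] algebra_simps)
    moreover have "cmod z > 0"
      using z rate by linarith
    then have "cmod z ^ k > 0"
      by simp
    ultimately show ?thesis
      by (simp add: power_divide field_simps)
  qed
  then have "cmod (v i) \<le> 0"
    by (rule tendsto_le_power_imp_nonpos) (use z rate in \<open>simp_all add: divide_less_eq\<close>)
  then show ?thesis by simp
qed

text \<open>P preserves the coordinate sum, while on an eigenvector it multiplies the sum by z;
  hence z = 1 or the sum is 0.\<close>

lemma large_eigenvalues: "{z \<in> eigenvalues S P. r < cmod z} = {1}"
proof (intro equalityI subsetI)
  fix z assume "z \<in> {z \<in> eigenvalues S P. r < cmod z}"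
  then obtain v i where z: "r < cmod z" and i: "i \<in> S" "v i \<noteq> 0"
    and v: "\<And>i. i \<in> S \<Longrightarrow> (\<Sum>j\<in>S. complex_of_real (P i j) * v j) = z * v i"
    by (auto simp: eigenvalues_def)
  have "z * (\<Sum>i\<in>S. v i) = (\<Sum>i\<in>S. \<Sum>j\<in>S. complex_of_real (P i j) * v j)"
    by (simp add: v sum_distrib_left)
  also have "\<dots> = (\<Sum>j\<in>S. complex_of_real (\<Sum>i\<in>S. P i j) * v j)"
    by (subst sum.swap) (simp add: sum_distrib_right)
  also have "\<dots> = (\<Sum>j\<in>S. v j)"
    by (simp add: column_sum)
  finally have "z = 1 \<or> (\<Sum>j\<in>S. v j) = 0"
    by auto
  then show "z \<in> {1}"
    using eigenvector_sum_0[OF v _ z i(1)] i(2) by auto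
next
  have "(\<Sum>j\<in>S. complex_of_real (P i j) * 1) = 1 * 1" if "i \<in> S" for i
    using row_sum[OF that] by (simp flip: of_real_sum)
  then have "1 \<in> eigenvalues S P"
    using states_nonempty unfolding eigenvalues_def by (intro CollectI exI[of _ "\<lambda>_. 1"]) auto
  then show "z \<in> {z \<in> eigenvalues S P. r < cmod z}" if "z \<in> {1}" for z
    using that rate by simp
qed

text \<open>The difference of a stationary and the uniform distribution is fixed by P and sums to 0,
  so it vanishes by the eigenvector estimate at z = 1 > r.\<close>

lemma stationary_iff_uniform: "stationary S P \<mu> \<longleftrightarrow> \<mu> = pmf_of_set S"
proof
  assume st: "stationary S P \<mu>"
  then have sub: "set_pmf \<mu> \<subseteq> S" and eq: "\<And>i. i \<in> S \<Longrightarrow> (\<Sum>j\<in>S. P i j * pmf \<mu> j) = pmf \<mu> i"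
    by (auto simp: stationary_def)
  define v where "v i = complex_of_real (pmf \<mu> i - 1 / card S)" for i
  have "(\<Sum>j\<in>S. complex_of_real (P i j) * v j) = 1 * v i" if "i \<in> S" for i
  proof -
    have "(\<Sum>j\<in>S. P i j * (pmf \<mu> j - 1 / card S)) = pmf \<mu> i - 1 / card S"
      using eq[OF that] row_sum[OF that]
      by (simp add: right_diff_distrib sum_subtractf flip: sum_divide_distrib)
    then have "complex_of_real (\<Sum>j\<in>S. P i j * (pmf \<mu> j - 1 / card S)) = v i"
      unfolding v_def by (rule arg_cong)
    then show ?thesis
      by (simp add: v_def)
  qed
  moreover have "(\<Sum>j\<in>S. v j) = complex_of_real ((\<Sum>j\<in>S. pmf \<mu> j) - card S * (1 / card S))"
    by (simp add: v_def sum_subtractf)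
  then have "(\<Sum>j\<in>S. v j) = 0"
    using finite_states states_nonempty sum_pmf_eq_1[OF finite_states sub] by simp
  ultimately have v0: "v i = 0" if "i \<in> S" for i
    using that rate by (intro eigenvector_sum_0[of v 1]) auto
  show "\<mu> = pmf_of_set S"
  proof (rule pmf_eqI)
    fix i show "pmf \<mu> i = pmf (pmf_of_set S) i"
    proof (cases "i \<in> S")
      case True
      then show ?thesis
        using v0[OF True] finite_states states_nonempty by (simp add: v_def del: of_real_diff)
    next
      case False
      then have "i \<notin> set_pmf \<mu>"
        using sub by blast
      then show ?thesis
        using False finite_states states_nonempty by (simp add: set_pmf_iff)
    qed
  qed
next
  assume "\<mu> = pmf_of_set S"
  then show "stationary S P \<mu>"
    using finite_states states_nonempty row_sum
    by (simp add: stationary_def flip: sum_divide_distrib)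
qed

end

subsection \<open>Powers of the shuffle matrix\<close>

context card_shuffle
begin

abbreviation "P \<equiv> shuffle_matrix C \<gamma> n"

lemma keeps_one: "b \<le> n \<Longrightarrow> keeps b \<one>\<^bsub>G\<^esub>"
  by (auto simp: keeps_def strict_mono_on_def refl_group_one)

text \<open>A strictly increasing self-map of {1..n} is the identity: its value at x is at least x
  by upward and at most x by downward induction.\<close>

lemma keeps_all_iff:
  assumes g: "g \<in> carrier G"
  shows "keeps n g \<longleftrightarrow> g = \<one>\<^bsub>G\<^esub>"
proof
  let ?p = "\<lambda>x. fst (g (x, \<one>))"
  assume k: "keeps n g"
  then have less: "?p x < ?p y" if "x \<in> {1..n}" "y \<in> {1..n}" "x < y" for x y
    using that by (auto simp: keeps_def strict_mono_on_def)
  have ge: "x \<le> n \<Longrightarrow> x \<le> ?p x" if "x \<ge> 1" for x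
    using that
  proof (induction x rule: nat_induct_at_least)
    case base
    then show ?case using position_closed[OF g, of 1] by simp
  next
    case (Suc x)
    then show ?case using less[of x "Suc x"] by simp
  qed
  have le: "x \<ge> 1 \<Longrightarrow> ?p x \<le> x" if "x \<le> n" for x
    using that
  proof (induction x rule: inc_induct)
    case base
    then show ?case using position_closed[OF g, of n] by simp
  next
    case (step x)
    then show ?case using less[of x "Suc x"] by simp
  qed
  show "g = \<one>\<^bsub>G\<^esub>"
  proof (rule refl_group_eqI[OF g G.one_closed])
    fix x assume x: "x \<in> {1..n}"
    then have "?p x = x" "snd (g (x, \<one>)) = \<one>"
      using ge[of x] le[of x] k by (auto simp: keeps_def)
    then show "g (x, \<one>) = \<one>\<^bsub>G\<^esub> (x, \<one>)"
      using x by (simp add: refl_group_one prod_eq_iff)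
  qed
qed (simp add: keeps_one)

lemma mat_pow_shuffle_matrix:
  assumes i: "i \<in> carrier G" and j: "j \<in> carrier G"
  shows "mat_pow (carrier G) P k i j = (\<Sum>a\<le>n. real (Stirling k a) / (real m ^ a * real n ^ k) *
    of_bool (keeps (n - a) (i \<otimes>\<^bsub>G\<^esub> inv\<^bsub>G\<^esub> j)))"
  using i
proof (induction k arbitrary: i)
  case 0
  have "i \<otimes>\<^bsub>G\<^esub> inv\<^bsub>G\<^esub> j = \<one>\<^bsub>G\<^esub> \<longleftrightarrow> i = j"
    using 0 j G.inv_solve_right[of "\<one>\<^bsub>G\<^esub>" i j] by auto
  then have "keeps n (i \<otimes>\<^bsub>G\<^esub> inv\<^bsub>G\<^esub> j) \<longleftrightarrow> i = j"
    using keeps_all_iff[of "i \<otimes>\<^bsub>G\<^esub> inv\<^bsub>G\<^esub> j"] 0 j by simp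
  then show ?case
    by (subst sum.atMost_shift) simp
next
  case (Suc k)
  let ?g = "i \<otimes>\<^bsub>G\<^esub> inv\<^bsub>G\<^esub> j"
  define K :: "nat \<Rightarrow> real" where "K a = of_bool (keeps (n - a) ?g)" for a
  define c where "c a = real (Stirling k a) / (real m ^ a * real n ^ k)" for a
  have "mat_pow (carrier G) P (Suc k) i j =
      (\<Sum>l\<in>carrier G. \<Sum>a\<le>n. c a * (P i l * of_bool (keeps (n - a) (l \<otimes>\<^bsub>G\<^esub> inv\<^bsub>G\<^esub> j))))"
    by (simp add: Suc.IH c_def sum_distrib_left algebra_simps)
  also have "\<dots> = (\<Sum>a\<le>n. c a * (\<Sum>l\<in>carrier G. P i l * of_bool (keeps (n - a) (l \<otimes>\<^bsub>G\<^esub> inv\<^bsub>G\<^esub> j))))"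
    by (subst sum.swap) (simp only: sum_distrib_left)
  also have "\<dots> = (\<Sum>a\<le>n. c a * (real a / real n * K a) +
      (if a = n then 0 else c a * (K (Suc a) / (real m * real n))))"
    using shuffle_matrix_keeps[OF Suc.prems G.inv_closed[OF j]]
    by (intro sum.cong refl) (auto simp: K_def distrib_left)
  also have "\<dots> = (\<Sum>a\<le>n. c a * (real a / real n * K a)) +
      (\<Sum>a\<le>n. if a = n then 0 else c a * (K (Suc a) / (real m * real n)))"
    by (rule sum.distrib)
  \<comment> \<open>The factor \<open>real a\<close> removes a = 0, and a = n gives nothing in the
    second sum. So both can be collected at \<open>Suc a\<close>, where the Stirling recurrence
    merges them.\<close>
  also have "(\<Sum>a\<le>n. c a * (real a / real n * K a)) =
      (\<Sum>a<n. c (Suc a) * (real (Suc a) / real n * K (Suc a)))"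
    by (subst sum.atMost_shift) simp
  also have "(\<Sum>a\<le>n. if a = n then 0 else c a * (K (Suc a) / (real m * real n))) =
      (\<Sum>a<n. c a * (K (Suc a) / (real m * real n)))"
    by (simp add: lessThan_Suc_atMost[symmetric])
  also have "(\<Sum>a<n. c (Suc a) * (real (Suc a) / real n * K (Suc a))) +
      (\<Sum>a<n. c a * (K (Suc a) / (real m * real n))) =
      (\<Sum>a<n. real (Stirling (Suc k) (Suc a)) / (real m ^ Suc a * real n ^ Suc k) * K (Suc a))"
    unfolding sum.distrib[symmetric]
    by (intro sum.cong refl) (simp add: c_def add_divide_distrib algebra_simps)
  also have "\<dots> = (\<Sum>a\<le>n. real (Stirling (Suc k) a) / (real m ^ a * real n ^ Suc k) * K a)"
    by (subst sum.atMost_shift) simp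
  finally show ?case
    by (simp only: K_def)
qed

lemma doubly_stochastic_shuffle_matrix: "doubly_stochastic (carrier G) P"
  unfolding doubly_stochastic_def
proof (intro conjI ballI)
  show "0 \<le> P g h" if "g \<in> carrier G" "h \<in> carrier G" for g h
    using that by (simp add: shuffle_matrix_eq sum_nonneg)
  show "(\<Sum>h\<in>carrier G. P g h) = 1" if "g \<in> carrier G" for g
    \<comment> \<open>\<open>keeps 0\<close> is the constant function 1, so the case b = 0 is the
      row sum.\<close>
    using shuffle_matrix_keeps[OF that G.one_closed, of 0] n_pos by simp
  show "(\<Sum>g\<in>carrier G. P g h) = 1" if h: "h \<in> carrier G" for h
  proof -
    have "(\<Sum>g\<in>carrier G. P g h) =
        (\<Sum>g\<in>carrier G. \<Sum>j=1..n. \<Sum>k<m. of_bool (insertion j k \<otimes>\<^bsub>G\<^esub> h = g)) / (real m * real n)"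
      using h by (simp add: shuffle_matrix_eq sum_divide_distrib)
    also have "(\<Sum>g\<in>carrier G. \<Sum>j=1..n. \<Sum>k<m. of_bool (insertion j k \<otimes>\<^bsub>G\<^esub> h = g)) =
        (\<Sum>j=1..n. \<Sum>g\<in>carrier G. \<Sum>k<m. of_bool (insertion j k \<otimes>\<^bsub>G\<^esub> h = g) :: real)"
      by (rule sum.swap)
    also have "\<dots> = (\<Sum>j=1..n. \<Sum>k<m. \<Sum>g\<in>carrier G. of_bool (insertion j k \<otimes>\<^bsub>G\<^esub> h = g))"
      by (intro sum.cong refl sum.swap)
    also have "\<dots> = (\<Sum>j=1..n. \<Sum>k<m. 1)"
      using h finite_refl_group by (intro sum.cong refl) (simp add: of_bool_def insertion_closed)
    finally show ?thesis
      using m_pos n_pos by simp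
  qed
qed

section \<open>Ergodicity from positive coefficients\<close>

lemma mat_pow_pos:
  assumes "i \<in> carrier G" "j \<in> carrier G" "a \<le> n" "Stirling k a > 0"
    and "keeps (n - a) (i \<otimes>\<^bsub>G\<^esub> inv\<^bsub>G\<^esub> j)"
  shows "mat_pow (carrier G) P k i j > 0"
  unfolding mat_pow_shuffle_matrix[OF assms(1,2)]
  by (rule sum_pos2[of _ a]) (use assms m_pos n_pos in auto)

lemma ergodic_shuffle_matrix: "ergodic_chain (carrier G) P"
  unfolding ergodic_chain_def
proof
  show "irreducible_chain (carrier G) P"
    unfolding irreducible_chain_def
    \<comment> \<open>After n shuffles every entry is positive: S(n, n) = 1 and
      \<open>keeps 0\<close> holds everywhere.\<close>
    by (intro ballI exI[of _ n] mat_pow_pos[of _ _ n]) simp_all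
  show "aperiodic_chain (carrier G) P"
    unfolding aperiodic_chain_def
  proof
    fix i assume i: "i \<in> carrier G"
    \<comment> \<open>One shuffle may put the bottom card back unrotated, so every state has a
      loop.\<close>
    have "mat_pow (carrier G) P 1 i i > 0"
      using i n_pos by (intro mat_pow_pos[of _ _ 1]) (simp_all add: keeps_one)
    then have "Gcd {k. 1 \<le> k \<and> 0 < mat_pow (carrier G) P k i i} dvd 1"
      by (intro Gcd_dvd) simp
    then show "Gcd {k. 1 \<le> k \<and> 0 < mat_pow (carrier G) P k i i} = 1"
      by simp
  qed
qed

section \<open>Rate of convergence and second eigenvalue\<close>

text \<open>\<open>L / n\<close> is the second eigenvalue: \<open>L = n - 1\<close> if \<open>m > 1\<close>, while \<open>L = n - 2\<close> if \<open>m = 1\<close>, because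
  without colours a single card is always in order.\<close>

context
  fixes L :: nat
  assumes L: "L < n"
    and weights: "\<And>a. L < a \<Longrightarrow> a \<le> n \<Longrightarrow> m ^ a = m ^ n * fact (n - a)"
    and keeps_beyond: "\<And>a g. L < a \<Longrightarrow> a \<le> n \<Longrightarrow> g \<in> carrier G \<Longrightarrow> keeps (n - a) g"
begin

lemma mat_pow_bound:
  assumes i: "i \<in> carrier G" and j: "j \<in> carrier G"
  shows "\<bar>mat_pow (carrier G) P k i j - 1 / (real m ^ n * fact n)\<bar> \<le> real (L + 1) * (real L / real n) ^ k"
proof -
  define K :: "nat \<Rightarrow> real" where "K a = of_bool (keeps (n - a) (i \<otimes>\<^bsub>G\<^esub> inv\<^bsub>G\<^esub> j))" for a
  \<comment> \<open>A fraction 1 / (m^b b!) of the group satisfies \<open>keeps b\<close>. With b =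
    n - a, the subtracted number is therefore the mean of \<open>K a / real m ^ a\<close> over the
    group. \<open>weights\<close> says that beyond \<open>L\<close> this fraction is 1.\<close>
  define d where "d a = K a / real m ^ a - 1 / (real m ^ n * fact (n - a))" for a
  have m: "real m \<ge> 1" using m_pos by simp
  have n: "real n > 0" using n_pos by simp
  have d_0: "d a = 0" if "L < a" "a \<le> n" for a
  proof -
    have "K a = 1"
      using keeps_beyond[OF that] i j by (simp add: K_def)
    moreover have "real m ^ a = real m ^ n * fact (n - a)"
      using arg_cong[OF weights[OF that], of real] by simp
    ultimately show ?thesis
      by (simp add: d_def)
  qed
  have d_1: "\<bar>d a\<bar> \<le> 1" for a
  proof -
    have "1 \<le> real m ^ n * fact (n - a)"
      using mult_mono[of 1 "real m ^ n" 1 "fact (n - a)"] m by (simp add: one_le_power fact_ge_1)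
    then have "0 \<le> 1 / (real m ^ n * fact (n - a))" "1 / (real m ^ n * fact (n - a)) \<le> 1"
      by (simp_all add: divide_le_eq_1)
    moreover have "0 \<le> K a / real m ^ a" "K a / real m ^ a \<le> 1"
      using m one_le_power[OF m, of a] by (simp_all add: K_def divide_le_eq_1)
    ultimately show ?thesis
      unfolding d_def by linarith
  qed
  have "1 / (real m ^ n * fact n) =
      (\<Sum>a\<le>n. real (Stirling k a) * (fact n / fact (n - a))) / (real n ^ k * (real m ^ n * fact n))"
    using n unfolding sum_Stirling_ffact by simp
  also have "\<dots> = (\<Sum>a\<le>n. real (Stirling k a) / real n ^ k * (1 / (real m ^ n * fact (n - a))))"
    unfolding sum_divide_distrib by (intro sum.cong refl) (simp add: field_simps)
  finally have "mat_pow (carrier G) P k i j - 1 / (real m ^ n * fact n) =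
      (\<Sum>a\<le>n. real (Stirling k a) / real n ^ k * d a)"
    unfolding mat_pow_shuffle_matrix[OF i j] d_def
    by (simp add: sum_subtractf right_diff_distrib K_def mult.commute)
  also have "\<dots> = (\<Sum>a\<le>L. real (Stirling k a) / real n ^ k * d a)"
    using L by (intro sum.mono_neutral_right) (auto simp: d_0)
  also have "\<bar>\<dots>\<bar> \<le> (\<Sum>a\<le>L. \<bar>real (Stirling k a) / real n ^ k * d a\<bar>)"
    by (rule sum_abs)
  \<comment> \<open>There are \<open>L + 1\<close> summands left, which is the constant of the
    bound; each is controlled by S(k, a) <= a^k <= L^k.\<close>
  also have "\<dots> \<le> (\<Sum>a\<le>L. (real L / real n) ^ k)"
  proof (rule sum_mono)
    fix a assume a: "a \<in> {..L}"
    have "real (Stirling k a) \<le> real L ^ k"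
      using order_trans[OF Stirling_le_power power_mono[of "real a" "real L" k]] a by simp
    then have "real (Stirling k a) / real n ^ k * \<bar>d a\<bar> \<le> (real L ^ k / real n ^ k) * 1"
      by (intro mult_mono divide_right_mono d_1) simp_all
    then show "\<bar>real (Stirling k a) / real n ^ k * d a\<bar> \<le> (real L / real n) ^ k"
      by (simp add: abs_mult power_divide)
  qed
  finally show ?thesis
    by simp
qed

lemma geometric_mixing_shuffle_matrix:
  "geometric_mixing (carrier G) P (1 / (real m ^ n * fact n)) (real (L + 1)) (real L / real n)"
proof
  show "carrier G \<noteq> {}"
    using G.one_closed by blast
qed (use finite_refl_group doubly_stochastic_shuffle_matrix mat_pow_bound L in auto)

lemma eigenvalue_shuffle_matrix:
  assumes "m * (n - L) \<noteq> 1"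
  shows "complex_of_real (real L / real n) \<in> eigenvalues (carrier G) P"
proof -
  \<comment> \<open>The operator sends the indicator of \<open>keeps (n - L)\<close> to L/n times
    itself plus 1 / (m n) and fixes constants. Subtracting \<open>c\<close> absorbs the extra term,
    because c (1 - L/n) = 1 / (m n).\<close>
  define c where "c = 1 / (real m * real (n - L))"
  define v where "v g = of_bool (keeps (n - L) g) - c" for g
  have c: "c * real (n - L) = 1 / real m"
    using L by (simp add: c_def)
  have ev: "(\<Sum>h\<in>carrier G. P g h * v h) = real L / real n * v g" if g: "g \<in> carrier G" for g
  proof -
    have "keeps (n - Suc L) g"
      using keeps_beyond[of "Suc L" g] L g by simp
    then have "(\<Sum>h\<in>carrier G. P g h * of_bool (keeps (n - L) h)) =
        real L / real n * of_bool (keeps (n - L) g) + 1 / (real m * real n)"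
      using shuffle_matrix_keeps[OF g G.one_closed, of "n - L"] L g by simp
    moreover have "(\<Sum>h\<in>carrier G. P g h) = 1"
      using doubly_stochastic_shuffle_matrix g by (simp add: doubly_stochastic_def)
    ultimately have "(\<Sum>h\<in>carrier G. P g h * v h) =
        real L / real n * of_bool (keeps (n - L) g) + 1 / (real m * real n) - c"
      by (simp add: v_def right_diff_distrib sum_subtractf flip: sum_distrib_right)
    also have "1 / (real m * real n) = c * real (n - L) / real n"
      by (simp add: c)
    also have "real L / real n * of_bool (keeps (n - L) g) + c * real (n - L) / real n - c =
        real L / real n * v g"
      using L by (simp add: v_def of_nat_diff field_simps)
    finally show ?thesis .
  qed
  \<comment> \<open>The value of \<open>v\<close> at the identity is 1 - c. For m = 1 and L = n - 1
    it would be 0, and \<open>v\<close> would vanish altogether.\<close>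
  have "1 - c \<noteq> 0"
  proof
    assume "1 - c = 0"
    then have "real (m * (n - L)) = 1"
      using m_pos L by (simp add: c_def field_simps)
    with assms show False
      by (simp only: of_nat_eq_1_iff)
  qed
  then have "v \<one>\<^bsub>G\<^esub> \<noteq> 0"
    by (simp add: v_def keeps_one)
  show ?thesis
    unfolding eigenvalues_def
  proof (intro CollectI exI[of _ "\<lambda>g. complex_of_real (v g)"] conjI ballI bexI[of _ "\<one>\<^bsub>G\<^esub>"])
    show "complex_of_real (v \<one>\<^bsub>G\<^esub>) \<noteq> 0"
      using \<open>v \<one>\<^bsub>G\<^esub> \<noteq> 0\<close> by simp
    fix g assume "g \<in> carrier G"
    then show "(\<Sum>h\<in>carrier G. complex_of_real (P g h) * complex_of_real (v h)) =
        complex_of_real (real L / real n) * complex_of_real (v g)"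
      using arg_cong[OF ev, of g complex_of_real] by simp
  qed simp
qed

lemma second_largest_eigenvalue_shuffle_matrix:
  "m * (n - L) \<noteq> 1 \<Longrightarrow> second_largest_eigenvalue (carrier G) P (real L / real n)"
  unfolding second_largest_eigenvalue_def
    geometric_mixing.large_eigenvalues[OF geometric_mixing_shuffle_matrix]
  using eigenvalue_shuffle_matrix by simp

end

lemma keeps_1_if_trivial_colors:
  assumes "m = 1" "g \<in> carrier G"
  shows "keeps (Suc 0) g"
proof -
  have "carrier C = {\<one>}"
    using assms(1) one_closed unfolding Coset.order_def by (metis card_1_singletonE singletonD)
  then have "snd (g (1, \<one>)) = \<one>"
    using color_closed[OF assms(2), of 1] n_pos by simp
  then show ?thesis
    by (simp add: keeps_def strict_mono_on_def)
qed

text \<open>The rate (n - 1) / n is valid for all m and n, even m = n = 1, so the stationary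
  distribution is settled without a case distinction.\<close>

lemma geometric_mixing_uniform:
  "geometric_mixing (carrier G) P (1 / (real m ^ n * fact n)) (real (n - 1 + 1)) (real (n - 1) / real n)"
proof (rule geometric_mixing_shuffle_matrix)
  show "m ^ a = m ^ n * fact (n - a)" if "n - 1 < a" "a \<le> n" for a
    using that by (cases "a = n") simp_all
  show "keeps (n - a) g" if "n - 1 < a" "a \<le> n" for a g
    using that by (cases "a = n") simp_all
qed (use n_pos in simp)

end

(* The case m = n = 1 is excluded from the last part: there P is the 1 x 1 matrix (1), which has
   no second eigenvalue, and (n - 2) / n = -1, so the printed bound would be negative for odd k. *)

theorem mainTheorem2:
  fixes C :: "('c, 'z) monoid_scheme" and \<gamma> :: 'c and m n :: nat
  assumes "group C" and "\<gamma> \<in> carrier C" and "carrier C = generate C {\<gamma>}" and "Coset.order C = m"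
    and "m \<ge> 1" and "n \<ge> 1"
  shows "let S = carrier (refl_group C n); P = shuffle_matrix C \<gamma> n in
    doubly_stochastic S P \<and>
    ergodic_chain S P \<and>
    (\<forall>\<mu>. stationary S P \<mu> \<longleftrightarrow> \<mu> = pmf_of_set S) \<and>
    (\<not> (m = 1 \<and> n = 1) \<longrightarrow>
      second_largest_eigenvalue S P
        (if m = 1 then (real n - 2) / real n else (real n - 1) / real n) \<and>
      (\<exists>\<alpha>>0. \<forall>k\<ge>1. \<forall>i\<in>S. \<forall>j\<in>S.
        \<bar>mat_pow S P k i j - 1 / (real m ^ n * fact n)\<bar> \<le>
          (if m = 1 then \<alpha> * ((real n - 2) / real n) ^ k
           else \<alpha> * ((real n - 1) / real n) ^ k)))"
proof -
  interpret group C by fact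
  interpret card_shuffle C n \<gamma>
    by unfold_locales
      (use assms order_gt_0_iff_finite in \<open>simp_all add: Coset.order_def card_gt_0_iff Suc_le_eq\<close>)
  have m: "Coset.order C = m" by fact
  \<comment> \<open>For m = n = 1 truncated subtraction would give 0 instead of -1;
    \<open>main\<close> and \<open>L_eq\<close> exclude that case.\<close>
  define L where "L = (if m = 1 then n - 2 else n - 1)"
  have main: "second_largest_eigenvalue (carrier G) P (real L / real n) \<and>
      (\<forall>k. \<forall>i\<in>carrier G. \<forall>j\<in>carrier G.
        \<bar>mat_pow (carrier G) P k i j - 1 / (real m ^ n * fact n)\<bar> \<le>
          real (L + 1) * (real L / real n) ^ k)"
    if nontrivial: "\<not> (m = 1 \<and> n = 1)"
  proof -
    have L: "L < n"
      using \<open>n \<ge> 1\<close> nontrivial by (auto simp: L_def)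
    have cases: "a = n \<or> (m = 1 \<and> n - a = Suc 0)" if "L < a" "a \<le> n" for a
      using that by (auto simp: L_def split: if_splits)
    have weights: "Coset.order C ^ a = Coset.order C ^ n * fact (n - a)" if "L < a" "a \<le> n" for a
      using cases[OF that] m by auto
    have keeps: "keeps (n - a) g" if "L < a" "a \<le> n" "g \<in> carrier G" for a g
      using cases[OF that(1,2)] keeps_1_if_trivial_colors[OF _ that(3)] m by auto
    \<comment> \<open>The product is 2 if m = 1 and n >= 2, and it is m if m > 1.\<close>
    have "Coset.order C * (n - L) \<noteq> 1"
      using nontrivial \<open>n \<ge> 1\<close> \<open>m \<ge> 1\<close> m by (auto simp: L_def)
    then show ?thesis
      using second_largest_eigenvalue_shuffle_matrix[OF L weights keeps]
        mat_pow_bound[OF L weights keeps] m by blast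
  qed
  have L_eq: "real L = (if m = 1 then real n - 2 else real n - 1)" if "\<not> (m = 1 \<and> n = 1)"
    using that \<open>n \<ge> 1\<close> by (auto simp: L_def of_nat_diff)
  have "\<exists>\<alpha>>0. \<forall>k\<ge>1. \<forall>i\<in>carrier G. \<forall>j\<in>carrier G.
        \<bar>mat_pow (carrier G) P k i j - 1 / (real m ^ n * fact n)\<bar> \<le>
          (if m = 1 then \<alpha> * ((real n - 2) / real n) ^ k
           else \<alpha> * ((real n - 1) / real n) ^ k)" if "\<not> (m = 1 \<and> n = 1)"
    using main[OF that] L_eq[OF that] by (intro exI[of _ "real (L + 1)"]) auto
  moreover have "second_largest_eigenvalue (carrier G) P
      (if m = 1 then (real n - 2) / real n else (real n - 1) / real n)" if "\<not> (m = 1 \<and> n = 1)"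
    using main[OF that] L_eq[OF that] by (auto split: if_splits)
  ultimately show ?thesis
    unfolding Let_def
    using doubly_stochastic_shuffle_matrix ergodic_shuffle_matrix
      geometric_mixing.stationary_iff_uniform[OF geometric_mixing_uniform]
    by blast
qed

end
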